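(* Assume $S$ is a standard subdivision scheme and let $\tilde{\mathbf{x}}_m$ be the PN subdivision rings around an isolated extraordinary vertex with control points $Q_m=S_{m-1}\cdots S_1S_0Q$ and control normals $\mathbf{n}_l^m$, $l=0,1,\ldots,\bar l$. Then $\tilde{\mathbf{x}}_m$ converges to a point as $m\to\infty$.
   Context: Setting. $Q=(\mathbf{q}_0;\ldots;\mathbf{q}_{\bar l})$ are control points in $\mathbb{R}^3$ around an isolated extraordinary vertex of valence $n$ and $\mathbf{n}_0^0,\ldots,\mathbf{n}_{\bar l}^0$ are unit control normals at these points. $S=(s_{ij})_{0\le i,j\le\bar l}$ is the subdivision matrix of a linear scheme, with all row sums 1. $S$ is standard if its eigenvalues satisfy $\lambda_0=1>\lambda_1=\lambda_2>|\lambda_3|\ge\cdots$, with two linearly independent eigenvectors for the double eigenvalue $\lambda=\lambda_1=\lambda_2$. Normals are refined by $\mathbf{n}_i^{k+1}=\sum_{j=0}^{\bar l}s_{ij}\mathbf{n}_j^k\big/\|\sum_{j=0}^{\bar l}s_{ij}\mathbf{n}_j^k\|$. Put $A(X_1,X_2)=\frac{X_1(X_1+X_2)^\top}{(X_1+X_2)^\top X_1}$ for unit vectors $X_1,X_2$, $A_{ij}^k=A(\mathbf{n}_i^{k+1},\mathbf{n}_j^k)$, $\tilde M_{ij}^k=I+\sum_{l=0}^{\bar l}s_{il}(A_{ij}^k-A_{il}^k)$ and $S_k=(s_{ij}\tilde M_{ij}^k)_{0\le i,j\le\bar l}$ (block matrix). The PN-subdivided control points of level $m$ are $Q_m=S_{m-1}\cdots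 S_1S_0Q$. Rings. Let $\Sigma^0=[0,1]^2\setminus[0,1/2)^2$, $\Sigma^m=2^{-m}\Sigma^0$, $\mathbf{S}_n^m=\Sigma^m\times\mathbb{Z}_n$. Away from the extraordinary vertex the mesh is regular, and the linear scheme generates from $Q_m$ the ring $\mathbf{x}_m(\mathbf{s})=G(2^m\mathbf{s})Q_m$, $\mathbf{s}\in\mathbf{S}_n^m$, where $G=(g_0,\ldots,g_{\bar l})$ are scalar generating functions of class $C^k$ on $\mathbf{S}_n^0$ with $\sum_l g_l=1$. It is computed recursively: $\lim_{j\to\infty}B_{m+j}(\mathbf{s})\cdots B_{m}(\mathbf{s})Q_m=\mathbf{x}_m(\mathbf{s})(1;\ldots;1)$, where the $B_{m+j}(\mathbf{s})$ are the matrices (fixed size, unit row sums) of the linear binary scheme on regular meshes taking the control points of the subpatch containing $\mathbf{s}$ at one level to those of the subpatch containing $\mathbf{s}$ at the next level. The PN ring $\tilde{\mathbf{x}}_m$ is the surface obtained by PN subdivision of the same control points $Q_m$ with the control normals $\mathbf{n}_l^m$: $\lim_{j\to\infty}\tilde B_{m+j}(\mathbf{s})\cdots\tilde B_{m}(\mathbf{s})Q_m=\tilde{\mathbf{x}}_m(\mathbf{s})(1;\ldots;1)$, where $\tilde B_{m+j}(\mathbf{s})$ is obtained from $B_{m+j}(\mathbf{s})$ by multiplying each entry $b_{ij}$ with the matrix $\tilde M_{ij}=I+\sum_l b_{il}(A_{ij}-A_{il})$, $A_{ij}=A(\mathbf{n}_i^{\mathrm{new}},\mathbf{n}_j^{\mathrm{old}})$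 formed from the refined normals (linear refinement by the same weights followed by normalization) at the corresponding points. Convergence of $\tilde{\mathbf{x}}_m$ to a point $\mathbf{p}_c$ means $\lim_{m\to\infty}\tilde{\mathbf{x}}_m(\mathbf{s})=\mathbf{p}_c$. Standing assumptions: the normals are dense enough that all denominators above do not vanish. Moreover, as known from the literature, there are constants $c_2>0$, $0<\gamma<1$ with $\|\mathbf{n}_j^k-\mathbf{n}_l^k\|\le c_2\gamma^k$ for $j,l\in\{0,\ldots,\bar l\}$ and all $k$, and linear and PN subdivision on regular meshes converge. *)

theory Defs
  imports "HOL-Analysis.Analysis" "Jordan_Normal_Form.Char_Poly"
begin

text \<open>
  Points and normals live in \<^typ>\<open>real ^ 3\<close>. A refinement step is given by real weights \<open>b i j\<close>
  over a finite index set \<open>J\<close>; the same step is used with \<open>J = {..L}\<close> and the subdivision matrix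
  around the extraordinary vertex, and with the stencil of a patch on the regular part of the mesh.
\<close>

subsection \<open>Point-normal refinement\<close>

definition A_mat :: "real ^ 3 \<Rightarrow> real ^ 3 \<Rightarrow> real ^ 3 ^ 3" where
  "A_mat X1 X2 = (1 / inner (X1 + X2) X1) *\<^sub>R ((columnvector X1 :: real ^ 1 ^ 3) ** rowvector (X1 + X2))"

definition refined_normal ::
  "('i \<Rightarrow> 'i \<Rightarrow> real) \<Rightarrow> 'i set \<Rightarrow> ('i \<Rightarrow> real ^ 3) \<Rightarrow> 'i \<Rightarrow> real ^ 3" where
  "refined_normal b J N i =
     (\<Sum>j\<in>J. b i j *\<^sub>R N j) /\<^sub>R norm (\<Sum>j\<in>J. b i j *\<^sub>R N j)"

definition M_mat ::
  "('i \<Rightarrow> 'i \<Rightarrow> real) \<Rightarrow> 'i set \<Rightarrow> ('i \<Rightarrow> real ^ 3) \<Rightarrow> 'i \<Rightarrow> 'i \<Rightarrow> real ^ 3 ^ 3" where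
  "M_mat b J N i j =
     Finite_Cartesian_Product.mat 1 +
     (\<Sum>l\<in>J. b i l *\<^sub>R (A_mat (refined_normal b J N i) (N j) - A_mat (refined_normal b J N i) (N l)))"

definition pn_step ::
  "('i \<Rightarrow> 'i \<Rightarrow> real) \<Rightarrow> 'i set \<Rightarrow> ('i \<Rightarrow> real ^ 3) \<Rightarrow> ('i \<Rightarrow> real ^ 3) \<Rightarrow> 'i \<Rightarrow> real ^ 3" where
  "pn_step b J N P i = (\<Sum>j\<in>J. (b i j *\<^sub>R M_mat b J N i j) *v P j)"

text \<open>Iteration with weights \<open>w k\<close> in the step from level \<open>k\<close> to level \<open>k + 1\<close>.\<close>

primrec linear_points ::
  "(nat \<Rightarrow> 'i \<Rightarrow> 'i \<Rightarrow> real) \<Rightarrow> 'i set \<Rightarrow> ('i \<Rightarrow> real ^ 3) \<Rightarrow> nat \<Rightarrow> 'i \<Rightarrow> real ^ 3" where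
  "linear_points w J P 0 = P"
| "linear_points w J P (Suc k) = (\<lambda>i. \<Sum>j\<in>J. w k i j *\<^sub>R linear_points w J P k j)"

primrec normals ::
  "(nat \<Rightarrow> 'i \<Rightarrow> 'i \<Rightarrow> real) \<Rightarrow> 'i set \<Rightarrow> ('i \<Rightarrow> real ^ 3) \<Rightarrow> nat \<Rightarrow> 'i \<Rightarrow> real ^ 3" where
  "normals w J N 0 = N"
| "normals w J N (Suc k) = refined_normal (w k) J (normals w J N k)"

primrec pn_points ::
  "(nat \<Rightarrow> 'i \<Rightarrow> 'i \<Rightarrow> real) \<Rightarrow> 'i set \<Rightarrow> ('i \<Rightarrow> real ^ 3) \<Rightarrow> ('i \<Rightarrow> real ^ 3) \<Rightarrow> nat \<Rightarrow> 'i \<Rightarrow> real ^ 3" where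
  "pn_points w J N P 0 = P"
| "pn_points w J N P (Suc k) = pn_step (w k) J (normals w J N k) (pn_points w J N P k)"

definition nonvanishing_denominators ::
  "(nat \<Rightarrow> 'i \<Rightarrow> 'i \<Rightarrow> real) \<Rightarrow> 'i set \<Rightarrow> ('i \<Rightarrow> real ^ 3) \<Rightarrow> bool" where
  "nonvanishing_denominators w J N \<longleftrightarrow>
     (\<forall>k. \<forall>i\<in>J. norm (\<Sum>j\<in>J. w k i j *\<^sub>R normals w J N k j) \<noteq> 0 \<and>
        (\<forall>j\<in>J. inner (normals w J N (Suc k) i + normals w J N k j) (normals w J N (Suc k) i) \<noteq> 0))"

subsection \<open>The subdivision matrix at the extraordinary vertex\<close>

definition unit_row_sums :: "real mat \<Rightarrow> bool" where
  "unit_row_sums S \<longleftrightarrow> (\<forall>i<dim_row S. (\<Sum>j<dim_col S. S $$ (i, j)) = 1)"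

text \<open>
  The list \<open>ls\<close> enumerates the complex eigenvalues with algebraic multiplicity. The chain of
  inequalities names \<open>ls ! 3\<close>, so there are at least four of them.
\<close>

definition standard_matrix :: "real mat \<Rightarrow> bool" where
  "standard_matrix S \<longleftrightarrow>
     (\<exists>(ls :: complex list) (lam :: real).
        char_poly (map_mat complex_of_real S) = (\<Prod>l\<leftarrow>ls. [:- l, 1:]) \<and>
        4 \<le> length ls \<and>
        ls ! 0 = 1 \<and> 1 > lam \<and> ls ! 1 = complex_of_real lam \<and> ls ! 2 = complex_of_real lam \<and>
        lam > cmod (ls ! 3) \<and>
        (\<forall>i j. 3 \<le> i \<and> i \<le> j \<and> j < length ls \<longrightarrow> cmod (ls ! i) \<ge> cmod (ls ! j)) \<and>
        (\<exists>v w. eigenvector S v lam \<and> eigenvector S w lam \<and>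
           (\<forall>a b. a \<cdot>\<^sub>v v + b \<cdot>\<^sub>v w = 0\<^sub>v (dim_row S) \<longrightarrow> a = 0 \<and> b = 0)))"

definition vertex_weights :: "real mat \<Rightarrow> nat \<Rightarrow> nat \<Rightarrow> nat \<Rightarrow> real" where
  "vertex_weights S k i j = S $$ (i, j)"

text \<open>
  With \<open>L + 1\<close> the size of \<open>S\<close>: the normals \<open>n\<^sub>l\<^sup>m\<close> and the points
  \<open>Q\<^sub>m = S\<^sub>m\<^sub>-\<^sub>1 \<cdots> S\<^sub>1 S\<^sub>0 Q\<close>.
\<close>

definition vertex_normals :: "nat \<Rightarrow> real mat \<Rightarrow> (nat \<Rightarrow> real ^ 3) \<Rightarrow> nat \<Rightarrow> nat \<Rightarrow> real ^ 3" where
  "vertex_normals L S N0 = normals (vertex_weights S) {..L} N0"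

definition vertex_points ::
  "nat \<Rightarrow> real mat \<Rightarrow> (nat \<Rightarrow> real ^ 3) \<Rightarrow> (nat \<Rightarrow> real ^ 3) \<Rightarrow> nat \<Rightarrow> nat \<Rightarrow> real ^ 3" where
  "vertex_points L S N0 Q = pn_points (vertex_weights S) {..L} N0 Q"

subsection \<open>Linear binary schemes on the regular mesh\<close>

text \<open>
  A scheme is given by its mask \<open>a\<close>: on \<open>\<int>\<^sup>2\<close> it maps \<open>P\<close> to
  \<open>\<alpha> \<mapsto> (\<Sum>\<beta>. a (\<alpha> - 2 \<beta>) P \<beta>)\<close>. The mesh points with indices in \<open>c + J\<close> control the
  patch over the cell \<open>c + [0,1]\<^sup>2\<close>; the last condition says that they determine the control points
  of its four subpatches.
\<close>

definition mask_weight :: "(int \<times> int \<Rightarrow> real) \<Rightarrow> int \<times> int \<Rightarrow> int \<times> int \<Rightarrow> real" where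
  "mask_weight a \<alpha> \<beta> = a (fst \<alpha> - 2 * fst \<beta>, snd \<alpha> - 2 * snd \<beta>)"

definition regular_scheme :: "(int \<times> int \<Rightarrow> real) \<Rightarrow> (int \<times> int) set \<Rightarrow> bool" where
  "regular_scheme a J \<longleftrightarrow>
     finite {\<alpha>. a \<alpha> \<noteq> 0} \<and>
     (\<forall>\<alpha>. (\<Sum>\<beta> | mask_weight a \<alpha> \<beta> \<noteq> 0. mask_weight a \<alpha> \<beta>) = 1) \<and>
     finite J \<and> J \<noteq> {} \<and>
     (\<forall>\<epsilon> \<in> {0,1} \<times> {0,1}. \<forall>\<alpha>\<in>J. \<forall>\<beta>. mask_weight a (\<epsilon> + \<alpha>) \<beta> \<noteq> 0 \<longrightarrow> \<beta> \<in> J)"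

text \<open>
  \<open>k j\<close> is the index of the cell chosen at level \<open>j\<close>, where cells have side length
  proportional to \<open>2\<^sup>-\<^sup>j\<close>.
\<close>

definition nested_cells :: "(nat \<Rightarrow> int \<times> int) \<Rightarrow> bool" where
  "nested_cells k \<longleftrightarrow>
     (\<forall>j. fst (k (Suc j)) - 2 * fst (k j) \<in> {0,1} \<and> snd (k (Suc j)) - 2 * snd (k j) \<in> {0,1})"

text \<open>The matrix from the control points of subpatch \<open>k j\<close> to those of subpatch \<open>k (j + 1)\<close>.\<close>

definition subpatch_matrix ::
  "(int \<times> int \<Rightarrow> real) \<Rightarrow> (nat \<Rightarrow> int \<times> int) \<Rightarrow> nat \<Rightarrow> int \<times> int \<Rightarrow> int \<times> int \<Rightarrow> real" where
  "subpatch_matrix a k j \<alpha> \<beta> = mask_weight a (k (Suc j) + \<alpha>) (k j + \<beta>)"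

definition regular_convergent :: "(int \<times> int \<Rightarrow> real) \<Rightarrow> (int \<times> int) set \<Rightarrow> bool" where
  "regular_convergent a J \<longleftrightarrow>
     (\<forall>k P. nested_cells k \<longrightarrow>
        (\<exists>p. \<forall>\<alpha>\<in>J. (\<lambda>j. linear_points (subpatch_matrix a k) J P j \<alpha>) \<longlonglongrightarrow> p))"

subsection \<open>Rings\<close>

definition Sig :: "nat \<Rightarrow> (real \<times> real) set" where
  "Sig m = (\<lambda>\<sigma>. (1 / 2 ^ m) *\<^sub>R \<sigma>) ` ({0..1} \<times> {0..1} - {0..<1/2} \<times> {0..<1/2})"

text \<open>The sectors \<open>\<int>\<^sub>n\<close> are represented by \<open>{..<n}\<close>.\<close>

definition ring_domain :: "nat \<Rightarrow> nat \<Rightarrow> ((real \<times> real) \<times> nat) set" where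
  "ring_domain n m = Sig m \<times> {..<n}"

text \<open>
  \<^term>\<open>Sig m\<close> is the union of three closed squares \<open>2\<^sup>-\<^sup>m\<^sup>-\<^sup>1 (c + [0,1]\<^sup>2)\<close>; these carry the
  subpatches of level \<open>m\<close>.
\<close>

definition ring_cells :: "(int \<times> int) set" where
  "ring_cells = {(1, 0), (0, 1), (1, 1)}"

text \<open>
  \<open>k j\<close> is the subpatch of level \<open>m + j\<close> containing \<open>\<sigma>\<close>. A point on a common edge
  of subpatches admits several chains.
\<close>

definition subpatch_chain :: "nat \<Rightarrow> real \<times> real \<Rightarrow> (nat \<Rightarrow> int \<times> int) \<Rightarrow> bool" where
  "subpatch_chain m \<sigma> k \<longleftrightarrow>
     k 0 \<in> ring_cells \<and> nested_cells k \<and>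
     (\<forall>j. 2 ^ (m + 1 + j) * fst \<sigma> \<in> {real_of_int (fst (k j)) .. real_of_int (fst (k j)) + 1} \<and>
          2 ^ (m + 1 + j) * snd \<sigma> \<in> {real_of_int (snd (k j)) .. real_of_int (snd (k j)) + 1})"

text \<open>Class \<open>C\<^sup>r\<close> on a (not necessarily open) planar set, with derivatives taken within the set.\<close>

primrec class_C :: "nat \<Rightarrow> (real \<times> real) set \<Rightarrow> (real \<times> real \<Rightarrow> real) \<Rightarrow> bool" where
  "class_C 0 U f \<longleftrightarrow> continuous_on U f"
| "class_C (Suc r) U f \<longleftrightarrow>
     (\<exists>f1 f2. class_C r U f1 \<and> class_C r U f2 \<and>
        (\<forall>p\<in>U. (f has_derivative (\<lambda>h. f1 p * fst h + f2 p * snd h)) (at p within U)))"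

text \<open>
  \<open>sel c i\<close> says which of the control points \<open>0, \<dots>, L\<close> of a level are the control points
  of the subpatch over the cell \<open>c\<close> in sector \<open>i\<close>.
\<close>

definition generating_functions ::
  "nat \<Rightarrow> nat \<Rightarrow> (int \<times> int \<Rightarrow> real) \<Rightarrow> (int \<times> int) set \<Rightarrow>
   (int \<times> int \<Rightarrow> nat \<Rightarrow> int \<times> int \<Rightarrow> nat) \<Rightarrow> nat \<Rightarrow>
   (nat \<Rightarrow> (real \<times> real) \<times> nat \<Rightarrow> real) \<Rightarrow> bool" where
  "generating_functions L n a J sel r G \<longleftrightarrow>
     (\<forall>l\<le>L. \<forall>i<n. class_C r (Sig 0) (\<lambda>\<sigma>. G l (\<sigma>, i))) \<and>
     (\<forall>s \<in> ring_domain n 0. (\<Sum>l\<le>L. G l s) = 1) \<and>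
     (\<forall>P \<sigma> i k. (\<sigma>, i) \<in> ring_domain n 0 \<longrightarrow> subpatch_chain 0 \<sigma> k \<longrightarrow>
        (\<forall>\<alpha>\<in>J. (\<lambda>j. linear_points (subpatch_matrix a k) J (\<lambda>\<beta>. P (sel (k 0) i \<beta>)) j \<alpha>)
            \<longlonglongrightarrow> (\<Sum>l\<le>L. G l (\<sigma>, i) *\<^sub>R P l)))"

text \<open>\<open>x m\<close> is the PN ring generated by the points \<open>Qs m\<close> and normals \<open>Ns m\<close>.\<close>

definition pn_rings ::
  "nat \<Rightarrow> (int \<times> int \<Rightarrow> real) \<Rightarrow> (int \<times> int) set \<Rightarrow> (int \<times> int \<Rightarrow> nat \<Rightarrow> int \<times> int \<Rightarrow> nat) \<Rightarrow>
   (nat \<Rightarrow> nat \<Rightarrow> real ^ 3) \<Rightarrow> (nat \<Rightarrow> nat \<Rightarrow> real ^ 3) \<Rightarrow>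
   (nat \<Rightarrow> (real \<times> real) \<times> nat \<Rightarrow> real ^ 3) \<Rightarrow> bool" where
  "pn_rings n a J sel Ns Qs x \<longleftrightarrow>
     (\<forall>m \<sigma> i k. (\<sigma>, i) \<in> ring_domain n m \<longrightarrow> subpatch_chain m \<sigma> k \<longrightarrow>
        (\<forall>\<alpha>\<in>J. (\<lambda>j. pn_points (subpatch_matrix a k) J
                   (\<lambda>\<beta>. Ns m (sel (k 0) i \<beta>)) (\<lambda>\<beta>. Qs m (sel (k 0) i \<beta>)) j \<alpha>)
            \<longlonglongrightarrow> x m (\<sigma>, i)))"

text \<open>The domains shrink with \<open>m\<close>, so the parameter has to vary with \<open>m\<close>.\<close>

definition rings_converge_to ::
  "nat \<Rightarrow> (nat \<Rightarrow> (real \<times> real) \<times> nat \<Rightarrow> real ^ 3) \<Rightarrow> real ^ 3 \<Rightarrow> bool" where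
  "rings_converge_to n x p \<longleftrightarrow>
     (\<forall>s. (\<forall>m. s m \<in> ring_domain n m) \<longrightarrow> (\<lambda>m. x m (s m)) \<longlonglongrightarrow> p)"

end

theory Submission
  imports Defs "Jordan_Normal_Form.Spectral_Radius"
begin

text \<open>
  The block row sums of a PN step are the identity, so it differs from the linear step by an operator
  that annihilates constants and is bounded by a multiple of the oscillation of the normals. The
  linear steps contract oscillations after boundedly many steps: at the extraordinary vertex because
  the eigenvalues other than 1 are smaller than 1 in modulus, and on the regular mesh because every
  infinite product of the four subpatch matrices converges to a constant, which a compactness argument
  on words makes uniform. This contraction survives small perturbations. Averaging followed by
  normalization is such a perturbation of linear refinement of the normals, so normals with small
  oscillation keep it small, and then the oscillations of the PN points are summable, with a sum at
  most a constant times the initial oscillation. Hence \<open>Q\<^sub>m\<close> converges to a single point, and each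
  point of the ring of level \<open>m\<close> is within a constant times the oscillation of \<open>Q\<^sub>m\<close> of the control
  points.
\<close>

subsection \<open>Oscillation and perturbed contractions\<close>

text \<open>The sum over all pairs stands in for the diameter: on a finite \<open>J\<close> it
  dominates every single distance and exceeds the largest one by at most a factor
  \<open>card J\<close> squared.\<close>

definition osc :: "'i set \<Rightarrow> ('i \<Rightarrow> 'a :: real_normed_vector) \<Rightarrow> real" where
  "osc J X = (\<Sum>i\<in>J. \<Sum>j\<in>J. norm (X i - X j))"

lemma osc_nonneg: "0 \<le> osc J X"
  by (simp add: osc_def sum_nonneg)

lemma norm_diff_le_osc:
  assumes "finite J" "i \<in> J" "j \<in> J"
  shows "norm (X i - X j) \<le> osc J X"
proof -
  have "norm (X i - X j) \<le> (\<Sum>j\<in>J. norm (X i - X j))"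
    using assms by (intro member_le_sum) auto
  also have "\<dots> \<le> osc J X"
    unfolding osc_def using assms by (intro member_le_sum) (auto intro: sum_nonneg)
  finally show ?thesis .
qed

lemma osc_le:
  assumes "\<And>i j. i \<in> J \<Longrightarrow> j \<in> J \<Longrightarrow> norm (X i - X j) \<le> c"
  shows "osc J X \<le> real (card J) ^ 2 * c"
proof -
  have "osc J X \<le> (\<Sum>i\<in>J. \<Sum>j\<in>J. c)"
    unfolding osc_def using assms by (intro sum_mono) auto
  then show ?thesis by (simp add: power2_eq_square)
qed

text \<open>Weights of sum 1 let \<open>c\<close> be moved inside the sum. Negative weights are
  allowed, hence the bound \<open>B\<close> on the absolute values. The general normed space covers
  vectors as well as inner products of normals.\<close>

lemma norm_weighted_sum_diff_le:
  fixes X :: "'i \<Rightarrow> 'a :: real_normed_vector"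
  assumes "(\<Sum>j\<in>J. b j) = 1" "(\<Sum>j\<in>J. \<bar>b j\<bar>) \<le> B" "\<And>j. j \<in> J \<Longrightarrow> norm (X j - c) \<le> d" "0 \<le> d"
  shows "norm ((\<Sum>j\<in>J. b j *\<^sub>R X j) - c) \<le> B * d"
proof -
  have "(\<Sum>j\<in>J. b j *\<^sub>R X j) - c = (\<Sum>j\<in>J. b j *\<^sub>R X j) - (\<Sum>j\<in>J. b j) *\<^sub>R c"
    using assms by simp
  also have "\<dots> = (\<Sum>j\<in>J. b j *\<^sub>R (X j - c))"
    by (simp add: scaleR_sum_left sum_subtractf algebra_simps)
  also have "norm \<dots> \<le> (\<Sum>j\<in>J. \<bar>b j\<bar> * d)"
    using assms by (intro order_trans[OF norm_sum] sum_mono) (auto intro: mult_left_mono)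
  also have "\<dots> \<le> B * d"
    using assms by (simp flip: sum_distrib_right add: mult_right_mono)
  finally show ?thesis .
qed

text \<open>Cut off a block of length \<open>s\<close>: it sums to at most
  \<open>s0 * c ^ s0 * u m\<close>, and by induction the rest is at most the claimed constant times
  \<open>3 / 4 * u m\<close>. The induction closes because
  \<open>s0 + 3 * (s0 + 1) \<le> 4 * (s0 + 1)\<close>. The finite horizon \<open>n\<close> allows
  use of the estimate while its hypotheses are still being established level by level.\<close>

lemma sum_le_of_eventual_contraction:
  fixes u :: "nat \<Rightarrow> real"
  assumes pos: "\<And>k. 0 \<le> u k" and c: "1 \<le> c"
    and step: "\<And>k. k < n \<Longrightarrow> u (Suc k) \<le> c * u k"
    and contr: "\<And>k. k + s0 \<le> n \<Longrightarrow> \<exists>s. 1 \<le> s \<and> s \<le> s0 \<and> u (k + s) \<le> 3 / 4 * u k"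
    and m: "m \<le> n"
  shows "(\<Sum>k=m..n. u k) \<le> 4 * (real s0 + 1) * c ^ s0 * u m"
  using m
proof (induction "n - m" arbitrary: m rule: less_induct)
  case less
  have growth: "m + t \<le> n \<Longrightarrow> u (m + t) \<le> c ^ t * u m" for t
  proof (induction t)
    case (Suc t)
    then have "u (m + Suc t) \<le> c * u (m + t)" using step[of "m + t"] by simp
    also have "\<dots> \<le> c * (c ^ t * u m)" using Suc c by (intro mult_left_mono) auto
    finally show ?case by simp
  qed simp
  have growth': "u (m + t) \<le> c ^ s0 * u m" if "m + t \<le> n" "t \<le> s0" for t
    using growth[OF that(1)] power_increasing[OF that(2) c] pos[of m]
    by (meson mult_right_mono order_trans)
  have block: "(\<Sum>k=m..<m+t. u k) \<le> real s0 * (c ^ s0 * u m)" if "m + t \<le> n" "t \<le> s0" for t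
  proof -
    have "(\<Sum>k=m..<m+t. u k) \<le> (\<Sum>k=m..<m+t. c ^ s0 * u m)"
    proof (intro sum_mono)
      fix k assume "k \<in> {m..<m+t}"
      then show "u k \<le> c ^ s0 * u m" using growth'[of "k - m"] that by auto
    qed
    also have "\<dots> = real t * (c ^ s0 * u m)" by simp
    also have "\<dots> \<le> real s0 * (c ^ s0 * u m)"
      using that c pos[of m] by (intro mult_right_mono) auto
    finally show ?thesis .
  qed
  have nn: "0 \<le> c ^ s0 * u m" using c pos[of m] by simp
  show ?case
  proof (cases "m + s0 \<le> n")
    case True
    then obtain s where s: "1 \<le> s" "s \<le> s0" "u (m + s) \<le> 3 / 4 * u m" using contr by blast
    have "(\<Sum>k=m..n. u k) = (\<Sum>k=m..<m+s. u k) + (\<Sum>k=m+s..n. u k)"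
      using s True by (simp add: sum.atLeastLessThan_concat flip: atLeastLessThanSuc_atLeastAtMost)
    also have "\<dots> \<le> real s0 * (c ^ s0 * u m) + 4 * (real s0 + 1) * c ^ s0 * u (m + s)"
      using less.hyps[of "m + s"] s True block[of s] by (intro add_mono) auto
    also have "\<dots> \<le> real s0 * (c ^ s0 * u m) + 4 * (real s0 + 1) * c ^ s0 * (3 / 4 * u m)"
      using s c by (intro add_left_mono mult_left_mono) auto
    also have "\<dots> \<le> 4 * (real s0 + 1) * c ^ s0 * u m"
      using nn by (simp add: algebra_simps)
    finally show ?thesis .
  next
    case False
    have "(\<Sum>k=m..n. u k) = (\<Sum>k=m..<m+(n-m). u k) + u n"
      using less.prems by (simp add: sum.last_plus add.commute)
    also have "\<dots> \<le> real s0 * (c ^ s0 * u m) + c ^ s0 * u m"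
      using block[of "n - m"] growth'[of "n - m"] False less.prems by (intro add_mono) auto
    also have "\<dots> \<le> 4 * (real s0 + 1) * c ^ s0 * u m"
      using nn by (simp add: algebra_simps)
    finally show ?thesis .
  qed
qed

section \<open>Linear refinement with small relative errors\<close>

definition unit_weights :: "('i \<Rightarrow> 'i \<Rightarrow> real) \<Rightarrow> 'i set \<Rightarrow> real \<Rightarrow> bool" where
  "unit_weights b J B \<longleftrightarrow> (\<forall>i\<in>J. (\<Sum>j\<in>J. b i j) = 1 \<and> (\<Sum>j\<in>J. \<bar>b i j\<bar>) \<le> B)"

text \<open>The factor 1/2 leaves a margin of 1/4 for perturbations, since the summation lemma only
  asks for a factor 3/4.\<close>

definition contracting :: "(nat \<Rightarrow> 'i \<Rightarrow> 'i \<Rightarrow> real) \<Rightarrow> 'i set \<Rightarrow> nat \<Rightarrow> bool" where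
  "contracting w J s \<longleftrightarrow> (\<forall>P. osc J (linear_points w J P s) \<le> osc J P / 2)"

lemma perturbed_step_bounds:
  fixes X :: "'i \<Rightarrow> 'a :: real_normed_vector"
  assumes J: "finite J" and b: "unit_weights b J B" and \<eta>: "\<eta> \<le> 1"
    and err: "\<And>i. i \<in> J \<Longrightarrow> norm (Y i - (\<Sum>j\<in>J. b i j *\<^sub>R X j)) \<le> \<eta> * osc J X"
  shows "i \<in> J \<Longrightarrow> c \<in> J \<Longrightarrow> norm (Y i - X c) \<le> (B + 1) * osc J X"
    and "osc J Y \<le> real (card J) ^ 2 * (2 * (B + 1)) * osc J X"
proof -
  show *: "norm (Y i - X c) \<le> (B + 1) * osc J X" if "i \<in> J" "c \<in> J" for i c
  proof -
    have "norm ((\<Sum>j\<in>J. b i j *\<^sub>R X j) - X c) \<le> B * osc J X"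
      using b that J by (intro norm_weighted_sum_diff_le norm_diff_le_osc osc_nonneg)
        (auto simp: unit_weights_def)
    moreover have "norm (Y i - (\<Sum>j\<in>J. b i j *\<^sub>R X j)) \<le> 1 * osc J X"
      using err[OF that(1)] \<eta> osc_nonneg[of J X] by (meson mult_right_mono order_trans)
    ultimately show ?thesis
      using norm_triangle_ineq[of "Y i - (\<Sum>j\<in>J. b i j *\<^sub>R X j)" "(\<Sum>j\<in>J. b i j *\<^sub>R X j) - X c"]
      by (simp add: algebra_simps)
  qed
  have "osc J Y \<le> real (card J) ^ 2 * (2 * (B + 1) * osc J X)"
  proof (rule osc_le)
    fix i j assume ij: "i \<in> J" "j \<in> J"
    show "norm (Y i - Y j) \<le> 2 * (B + 1) * osc J X"
      using norm_triangle_ineq4[of "Y i - X i" "Y j - X i"] *[OF ij(1,1)] *[OF ij(2,1)] by (simp add: algebra_simps)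
  qed
  then show "osc J Y \<le> real (card J) ^ 2 * (2 * (B + 1)) * osc J X" by (simp add: mult.assoc)
qed

lemma osc_perturbation:
  assumes J: "finite J"
    and d: "\<And>i. i \<in> J \<Longrightarrow> norm (X i - Y i) \<le> d"
  shows "osc J X \<le> osc J Y + real (card J) ^ 2 * (2 * d)"
proof -
  have "osc J X \<le> (\<Sum>i\<in>J. \<Sum>j\<in>J. norm (Y i - Y j) + 2 * d)"
    unfolding osc_def
  proof (intro sum_mono)
    fix i j assume "i \<in> J" "j \<in> J"
    then have "norm (X i - Y i) \<le> d" "norm (X j - Y j) \<le> d" using d by auto
    moreover have "X i - X j = (Y i - Y j) + ((X i - Y i) - (X j - Y j))" by simp
    ultimately show "norm (X i - X j) \<le> norm (Y i - Y j) + 2 * d"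
      using norm_triangle_ineq[of "Y i - Y j" "(X i - Y i) - (X j - Y j)"]
        norm_triangle_ineq4[of "X i - Y i" "X j - Y j"] by (smt (verit))
  qed
  also have "\<dots> = osc J Y + real (card J) ^ 2 * (2 * d)"
    by (simp add: osc_def sum.distrib power2_eq_square)
  finally show ?thesis .
qed

text \<open>Within \<open>s0\<close> steps the sequence drifts away from the linear iteration
  restarted at level \<open>k\<close> by a small multiple of \<open>osc J (X k)\<close>, which
  weakens the contraction factor from 1/2 to 3/4 at worst; the oscillations then sum up.
  \<open>\<eta>\<close> and \<open>K\<close> are chosen before \<open>w\<close>, so they are uniform
  over all weight sequences with the same \<open>B\<close> and \<open>s0\<close>.\<close>

lemma perturbed_contraction:
  fixes J :: "'i set"
  assumes J: "finite J" "J \<noteq> {}" and s0: "1 \<le> s0" and B: "1 \<le> B"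
  obtains \<eta> K :: real where "0 < \<eta>" "\<eta> \<le> 1" "0 < K"
    "\<And>w (X :: nat \<Rightarrow> 'i \<Rightarrow> real ^ 3) n. (\<And>k. unit_weights (w k) J B) \<Longrightarrow>
       (\<And>k. \<exists>s. 1 \<le> s \<and> s \<le> s0 \<and> contracting (\<lambda>t. w (k + t)) J s) \<Longrightarrow>
       (\<And>k i. k < n \<Longrightarrow> i \<in> J \<Longrightarrow>
          norm (X (Suc k) i - (\<Sum>j\<in>J. w k i j *\<^sub>R X k j)) \<le> \<eta> * osc J (X k)) \<Longrightarrow>
       (\<Sum>k\<le>n. osc J (X k)) \<le> K * osc J (X 0)"
proof -
  define c where "c = real (card J) ^ 2 * (2 * (B + 1))"
  \<comment> \<open>With this value a drift of \<open>\<eta> * s0 * c ^ s0 * osc J (X k)\<close> of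
    single points raises the oscillation by at most a quarter of \<open>osc J (X k)\<close>.\<close>
  define \<eta> where "\<eta> = 1 / (8 * real (card J) ^ 2 * real s0 * c ^ s0)"
  have card: "1 \<le> real (card J)" using J by (simp add: Suc_leI card_gt_0_iff)
  then have card2: "1 \<le> real (card J) ^ 2" by (rule one_le_power)
  have Bc: "B \<le> c" "1 \<le> c"
    using mult_mono[OF card2, of "B" "2 * (B + 1)"] B by (auto simp: c_def)
  then have cs: "1 \<le> c ^ s0" by simp
  have "1 * 1 \<le> real (card J) ^ 2 * real s0"
    using card2 s0 by (intro mult_mono) auto
  then have "1 * 1 \<le> (real (card J) ^ 2 * real s0) * c ^ s0"
    using cs by (intro mult_mono) auto
  then have den: "1 \<le> 8 * real (card J) ^ 2 * real s0 * c ^ s0" by (simp add: algebra_simps)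
  have \<eta>: "0 < \<eta>" "\<eta> \<le> 1"
    unfolding \<eta>_def using den by (auto simp only: divide_le_eq_1 zero_less_divide_iff)
  show ?thesis
  proof (rule that[OF \<eta>])
    show "0 < 4 * (real s0 + 1) * c ^ s0" using cs by (intro mult_pos_pos) auto
    fix w :: "nat \<Rightarrow> 'i \<Rightarrow> 'i \<Rightarrow> real" and X :: "nat \<Rightarrow> 'i \<Rightarrow> real ^ 3" and n
    assume w: "\<And>k. unit_weights (w k) J B"
      and con: "\<And>k. \<exists>s. 1 \<le> s \<and> s \<le> s0 \<and> contracting (\<lambda>t. w (k + t)) J s"
      and err: "\<And>k i. k < n \<Longrightarrow> i \<in> J \<Longrightarrow>
          norm (X (Suc k) i - (\<Sum>j\<in>J. w k i j *\<^sub>R X k j)) \<le> \<eta> * osc J (X k)"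
    have step: "osc J (X (Suc k)) \<le> c * osc J (X k)" if "k < n" for k
      unfolding c_def using perturbed_step_bounds(2)[OF J(1) w \<eta>(2) err] that by blast
    have "(\<Sum>k=0..n. osc J (X k)) \<le> 4 * (real s0 + 1) * c ^ s0 * osc J (X 0)"
    proof (rule sum_le_of_eventual_contraction[where u = "\<lambda>k. osc J (X k)", OF osc_nonneg Bc(2) step])
      fix k assume k: "k + s0 \<le> n"
      let ?L = "\<lambda>t. linear_points (\<lambda>t. w (k + t)) J (X k) t"
      have growth: "t \<le> s0 \<Longrightarrow> osc J (X (k + t)) \<le> c ^ t * osc J (X k)" for t
      proof (induction t)
        case (Suc t)
        then have "osc J (X (k + Suc t)) \<le> c * osc J (X (k + t))" using step[of "k + t"] k by simp
        also have "\<dots> \<le> c * (c ^ t * osc J (X k))" using Suc Bc by (intro mult_left_mono) auto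
        finally show ?case by simp
      qed simp
      \<comment> \<open>Each step multiplies the earlier drift by at most \<open>c\<close> and adds
        a relative error of at most \<open>\<eta> * c ^ Suc t\<close>, hence the form
        \<open>t * c ^ t\<close>.\<close>
      have E: "t \<le> s0 \<Longrightarrow> i \<in> J \<Longrightarrow> norm (X (k + t) i - ?L t i) \<le> \<eta> * (real t * c ^ t) * osc J (X k)"
        for t i
      proof (induction t arbitrary: i)
        case (Suc t)
        let ?m = "\<Sum>j\<in>J. w (k + t) i j *\<^sub>R X (k + t) j"
        have "norm (X (k + Suc t) i - ?m) \<le> \<eta> * osc J (X (k + t))"
          using err[of "k + t" i] Suc k by simp
        also have "\<dots> \<le> \<eta> * (c ^ t * osc J (X k))"
          using growth[of t] Suc \<eta> by (intro mult_left_mono) auto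
        also have "\<dots> \<le> \<eta> * (c ^ Suc t * osc J (X k))"
          using Bc \<eta> osc_nonneg[of J "X k"] by (intro mult_left_mono mult_right_mono) auto
        finally have 1: "norm (X (k + Suc t) i - ?m) \<le> \<eta> * c ^ Suc t * osc J (X k)" by simp
        have "norm (?m - ?L (Suc t) i) = norm (\<Sum>j\<in>J. w (k + t) i j *\<^sub>R (X (k + t) j - ?L t j))"
          by (simp add: algebra_simps sum_subtractf)
        also have "\<dots> \<le> (\<Sum>j\<in>J. \<bar>w (k + t) i j\<bar> * (\<eta> * (real t * c ^ t) * osc J (X k)))"
          using Suc by (intro order_trans[OF norm_sum] sum_mono) (auto intro: mult_left_mono)
        also have "\<dots> \<le> c * (\<eta> * (real t * c ^ t) * osc J (X k))"
        proof -
          have "(\<Sum>j\<in>J. \<bar>w (k + t) i j\<bar>) \<le> c"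
            using w[of "k + t"] Suc Bc by (auto simp: unit_weights_def intro: order_trans)
          then show ?thesis
            using \<eta> Bc osc_nonneg[of J "X k"] by (simp flip: sum_distrib_right add: mult_right_mono)
        qed
        finally have 2: "norm (?m - ?L (Suc t) i) \<le> \<eta> * (real t * c ^ Suc t) * osc J (X k)"
          by (simp add: algebra_simps)
        show ?case
          using 1 2 norm_triangle_ineq[of "X (k + Suc t) i - ?m" "?m - ?L (Suc t) i"]
          by (simp add: algebra_simps)
      qed simp
      obtain s where s: "1 \<le> s" "s \<le> s0" "contracting (\<lambda>t. w (k + t)) J s" using con by blast
      have "real s * c ^ s \<le> real s0 * c ^ s0"
        using s Bc by (intro mult_mono power_increasing) auto
      then have "\<eta> * (real s * c ^ s) * osc J (X k) \<le> \<eta> * (real s0 * c ^ s0) * osc J (X k)"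
        using \<eta> osc_nonneg[of J "X k"] by (intro mult_right_mono mult_left_mono) auto
      with E[OF s(2)] have "\<And>i. i \<in> J \<Longrightarrow> norm (X (k + s) i - ?L s i) \<le> \<eta> * (real s0 * c ^ s0) * osc J (X k)"
        by (meson order_trans)
      from osc_perturbation[where X = "X (k + s)" and Y = "?L s", OF J(1) this]
      have "osc J (X (k + s)) \<le> osc J (?L s) + real (card J) ^ 2 * (2 * (\<eta> * (real s0 * c ^ s0) * osc J (X k)))" .
      also have "real (card J) ^ 2 * (2 * (\<eta> * (real s0 * c ^ s0) * osc J (X k))) = osc J (X k) / 4"
      proof -
        have "8 * real (card J) ^ 2 * real s0 * c ^ s0 * \<eta> = 1"
        proof -
          have "D * (1 / D) = 1" if "1 \<le> D" for D :: real using that by simp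
          from this[OF den] show ?thesis unfolding \<eta>_def .
        qed
        then have "(8 * real (card J) ^ 2 * real s0 * c ^ s0 * \<eta>) * osc J (X k) / 4 = osc J (X k) / 4"
          by (simp only: mult_1)
        then show ?thesis by (simp add: algebra_simps)
      qed
      also have "osc J (?L s) \<le> osc J (X k) / 2" using s(3) by (simp add: contracting_def)
      finally show "\<exists>s. 1 \<le> s \<and> s \<le> s0 \<and> osc J (X (k + s)) \<le> 3 / 4 * osc J (X k)"
        using s by (intro exI[of _ s]) auto
    qed auto
    then show "(\<Sum>k\<le>n. osc J (X k)) \<le> 4 * (real s0 + 1) * c ^ s0 * osc J (X 0)"
      by (simp add: atLeast0AtMost)
  qed
qed

subsection \<open>Uniform contraction along infinite words of matrices\<close>

text \<open>Koenig's lemma for words over a finite alphabet; \<open>local\<close> says that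
  \<open>R e s\<close> sees only the first \<open>s\<close> letters of \<open>e\<close>. A prefix
  that extends to good words of every length always has a next letter with the same
  property.\<close>

lemma infinite_branch:
  fixes R :: "(nat \<Rightarrow> 'e) \<Rightarrow> nat \<Rightarrow> bool"
  assumes F: "finite F"
    and local: "\<And>e f s. (\<And>i. i < s \<Longrightarrow> e i = f i) \<Longrightarrow> R e s \<Longrightarrow> R f s"
    and long: "\<And>s0. \<exists>e. range e \<subseteq> F \<and> (\<forall>s\<le>s0. R e s)"
  shows "\<exists>e. range e \<subseteq> F \<and> (\<forall>s. R e s)"
proof -
  define Ext where "Ext n f \<longleftrightarrow>
    (\<forall>s0. \<exists>e. range e \<subseteq> F \<and> (\<forall>i<n. e i = f i) \<and> (\<forall>s\<le>s0. R e s))" for n f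
  have "\<exists>g. Ext (Suc n) g \<and> (g n \<in> F \<and> (\<forall>i<n. g i = f i))" if Ext: "Ext n f" for n f
  proof (rule ccontr)
    assume no: "\<not> ?thesis"
    \<comment> \<open>Otherwise every letter \<open>x\<close> comes with a length that no good word
      continuing with \<open>x\<close> reaches; a word good up to the maximum of these finitely many
      lengths contradicts the choice for its own next letter.\<close>
    have "\<exists>s0. \<forall>e. range e \<subseteq> F \<longrightarrow> (\<forall>i<Suc n. e i = (f(n := x)) i) \<longrightarrow> \<not> (\<forall>s\<le>s0. R e s)"
      if "x \<in> F" for x
    proof -
      have "(f(n := x)) n \<in> F \<and> (\<forall>i<n. (f(n := x)) i = f i)" using that by simp
      then have "\<not> Ext (Suc n) (f(n := x))" using no by blast
      then show ?thesis unfolding Ext_def by blast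
    qed
    then obtain s0 where s0: "\<And>x e. x \<in> F \<Longrightarrow> range e \<subseteq> F \<Longrightarrow>
        (\<forall>i<Suc n. e i = (f(n := x)) i) \<Longrightarrow> \<not> (\<forall>s\<le>s0 x. R e s)"
      by metis
    define m where "m = Max (s0 ` F)"
    obtain e where e: "range e \<subseteq> F" "\<forall>i<n. e i = f i" "\<forall>s\<le>m. R e s"
      using Ext unfolding Ext_def by blast
    have "e n \<in> F" using e(1) by blast
    then have "s0 (e n) \<le> m" unfolding m_def using F by simp
    then show False
      using s0[OF \<open>e n \<in> F\<close> e(1)] e(2,3) by (auto simp: less_Suc_eq)
  qed
  moreover have "Ext 0 (\<lambda>_. undefined)" using long by (simp add: Ext_def)
  ultimately have "\<exists>f. \<forall>n. Ext n (f n) \<and> (f (Suc n) n \<in> F \<and> (\<forall>i<n. f (Suc n) i = f n i))"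
    by (intro dependent_nat_choice) metis+
  then obtain f where f: "\<And>n. Ext n (f n)"
      "\<And>n. f (Suc n) n \<in> F \<and> (\<forall>i<n. f (Suc n) i = f n i)"
    by blast
  \<comment> \<open>Letter \<open>i\<close> is settled at stage \<open>Suc i\<close> and never
    changes afterwards, so the diagonal word agrees with every prefix.\<close>
  define e where "e i = f (Suc i) i" for i
  have agree: "i < n \<Longrightarrow> f n i = e i" for i n
  proof (induction n)
    case (Suc n)
    then show ?case using f(2)[of n] by (cases "i = n") (auto simp: e_def)
  qed simp
  have "R e s" for s
  proof -
    obtain g where "\<forall>i<s. g i = f s i" "R g s"
      using f(1)[of s] unfolding Ext_def by blast
    then show ?thesis using local[of s g e] agree by simp
  qed
  moreover have "range e \<subseteq> F" using f(2) by (auto simp: e_def)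
  ultimately show ?thesis by blast
qed


section \<open>Products of weights and contraction of linear refinement\<close>

lemma linear_points_cong:
  assumes "\<And>k. k < n \<Longrightarrow> w k = w' k"
  shows "linear_points w J P n = linear_points w' J P n"
  using assms by (induction n) auto

text \<open>Entries of the matrix product with later factors on the left; they present the iteration
  as one linear map whose coefficients do not depend on the points.\<close>

primrec weight_product :: "(nat \<Rightarrow> 'i \<Rightarrow> 'i \<Rightarrow> real) \<Rightarrow> 'i set \<Rightarrow> nat \<Rightarrow> 'i \<Rightarrow> 'i \<Rightarrow> real" where
  "weight_product w J 0 i j = (if i = j then 1 else 0)"
| "weight_product w J (Suc k) i j = (\<Sum>l\<in>J. w k i l * weight_product w J k l j)"

lemma linear_points_weight_product:
  assumes "finite J" "i \<in> J"
  shows "linear_points w J P k i = (\<Sum>j\<in>J. weight_product w J k i j *\<^sub>R P j)"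
  using assms(2)
proof (induction k arbitrary: i)
  case 0
  then show ?case using assms(1) by (simp add: if_distrib[of "\<lambda>c. c *\<^sub>R _"] cong: if_cong)
next
  case (Suc k)
  have "linear_points w J P (Suc k) i = (\<Sum>l\<in>J. \<Sum>j\<in>J. (w k i l * weight_product w J k l j) *\<^sub>R P j)"
    using Suc by (simp add: scaleR_sum_right)
  also have "\<dots> = (\<Sum>j\<in>J. \<Sum>l\<in>J. (w k i l * weight_product w J k l j) *\<^sub>R P j)"
    by (rule sum.swap)
  finally show ?case by (simp add: scaleR_sum_left)
qed

lemma weight_product_row_sum:
  assumes "finite J" "\<And>k. unit_weights (w k) J B" "i \<in> J"
  shows "(\<Sum>j\<in>J. weight_product w J k i j) = 1"
  using assms(3)
proof (induction k arbitrary: i)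
  case (Suc k)
  have "(\<Sum>j\<in>J. weight_product w J (Suc k) i j) = (\<Sum>l\<in>J. \<Sum>j\<in>J. w k i l * weight_product w J k l j)"
    by (simp only: weight_product.simps) (rule sum.swap)
  also have "\<dots> = (\<Sum>l\<in>J. w k i l)" using Suc by (simp flip: sum_distrib_left)
  finally show ?case using assms(2)[of k] Suc.prems by (simp add: unit_weights_def)
qed (use assms(1) in simp)

text \<open>The limit is assumed for each \<open>P\<close> separately, whereas contraction needs one
  \<open>s\<close> for all \<open>P\<close>. By linearity finitely many impulses suffice: they show
  that all differences between rows of the product tend to zero, and these differences bound the
  contraction factor.\<close>

lemma eventually_contracting:
  assumes J: "finite J" and w: "\<And>k. unit_weights (w k) J B"
    and lim: "\<And>P. (\<lambda>k. osc J (linear_points w J P k)) \<longlonglongrightarrow> 0"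
  shows "\<exists>s\<ge>1. contracting w J s"
proof (cases "J = {}")
  case True
  then show ?thesis by (auto simp: contracting_def osc_def)
next
  case False
  then obtain c where c: "c \<in> J" by blast
  let ?t = "weight_product w J"
  have "(\<lambda>k. ?t k i l - ?t k j l) \<longlonglongrightarrow> 0" if ij: "i \<in> J" "j \<in> J" and l: "l \<in> J" for i j l
  proof -
    obtain e :: "real ^ 3" where e: "norm e = 1" using vector_choose_size[of 1] by auto
    \<comment> \<open>An impulse of unit size at \<open>l\<close> reads off column \<open>l\<close>
      of the product.\<close>
    let ?P = "\<lambda>j. if j = l then e else 0"
    have lin: "linear_points w J ?P k i = ?t k i l *\<^sub>R e" if "i \<in> J" for k i
      using that J l by (simp add: linear_points_weight_product if_distrib[of "\<lambda>v. _ *\<^sub>R v"] cong: if_cong)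
    have "norm (?t k i l - ?t k j l) \<le> osc J (linear_points w J ?P k)" for k
      using norm_diff_le_osc[OF J ij, of "linear_points w J ?P k"] ij e
      by (simp add: lin flip: scaleR_left.diff)
    then show ?thesis by (intro Lim_null_comparison[OF _ lim[of ?P]]) auto
  qed
  then have "(\<lambda>k. \<Sum>i\<in>J. \<Sum>j\<in>J. \<Sum>l\<in>J. \<bar>?t k i l - ?t k j l\<bar>) \<longlonglongrightarrow> 0"
    by (intro tendsto_null_sum tendsto_rabs_zero)
  then have "\<forall>\<^sub>F k in sequentially. (\<Sum>i\<in>J. \<Sum>j\<in>J. \<Sum>l\<in>J. \<bar>?t k i l - ?t k j l\<bar>) < 1 / 2"
    by (rule order_tendstoD) simp
  then obtain s0 where "\<And>s. s \<ge> s0 \<Longrightarrow> (\<Sum>i\<in>J. \<Sum>j\<in>J. \<Sum>l\<in>J. \<bar>?t s i l - ?t s j l\<bar>) < 1 / 2"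
    unfolding eventually_sequentially by blast
  then obtain s where s: "s \<ge> 1" "(\<Sum>i\<in>J. \<Sum>j\<in>J. \<Sum>l\<in>J. \<bar>?t s i l - ?t s j l\<bar>) < 1 / 2"
    by (meson max.cobounded1 max.cobounded2)
  have "osc J (linear_points w J P s) \<le> osc J P / 2" for P
  proof -
    \<comment> \<open>Rows of sum 1 allow \<open>P c\<close> to be subtracted, which leaves only
      differences bounded by \<open>osc J P\<close>.\<close>
    have *: "linear_points w J P s i - P c = (\<Sum>l\<in>J. ?t s i l *\<^sub>R (P l - P c))" if "i \<in> J" for i
    proof -
      have "(\<Sum>l\<in>J. ?t s i l) *\<^sub>R P c = P c"
        using weight_product_row_sum[OF J w that] by simp
      then show ?thesis
        using that J
        by (simp only: linear_points_weight_product scaleR_sum_left scaleR_diff_right sum_subtractf)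
    qed
    have "osc J (linear_points w J P s) \<le> (\<Sum>i\<in>J. \<Sum>j\<in>J. \<Sum>l\<in>J. \<bar>?t s i l - ?t s j l\<bar> * osc J P)"
      unfolding osc_def[of J "linear_points w J P s"]
    proof (intro sum_mono)
      fix i j assume ij: "i \<in> J" "j \<in> J"
      have "linear_points w J P s i - linear_points w J P s j
          = (linear_points w J P s i - P c) - (linear_points w J P s j - P c)" by simp
      also have "\<dots> = (\<Sum>l\<in>J. (?t s i l - ?t s j l) *\<^sub>R (P l - P c))"
        using ij by (simp only: * scaleR_left.diff sum_subtractf)
      also have "norm \<dots> \<le> (\<Sum>l\<in>J. \<bar>?t s i l - ?t s j l\<bar> * osc J P)"
        using J c by (intro order_trans[OF norm_sum] sum_mono)
          (simp_all add: mult_left_mono norm_diff_le_osc)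
      finally show "norm (linear_points w J P s i - linear_points w J P s j)
          \<le> (\<Sum>l\<in>J. \<bar>?t s i l - ?t s j l\<bar> * osc J P)" .
    qed
    also have "\<dots> = (\<Sum>i\<in>J. \<Sum>j\<in>J. \<Sum>l\<in>J. \<bar>?t s i l - ?t s j l\<bar>) * osc J P"
      by (simp add: sum_distrib_right)
    also have "\<dots> \<le> 1 / 2 * osc J P"
      using s(2) osc_nonneg[of J P] by (intro mult_right_mono) auto
    finally show ?thesis by simp
  qed
  then show ?thesis using s(1) by (auto simp: contracting_def)
qed


text \<open>If no bound \<open>s0\<close> worked, there would be words without contraction up to
  every length, and by \<open>infinite_branch\<close> one infinite word that never contracts,
  against \<open>eventually_contracting\<close>.\<close>

lemma uniformly_contracting:
  fixes wt :: "'e \<Rightarrow> 'i \<Rightarrow> 'i \<Rightarrow> real"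
  assumes J: "finite J" and F: "finite F"
    and wt: "\<And>e. e \<in> F \<Longrightarrow> unit_weights (wt e) J B"
    and lim: "\<And>e P. range e \<subseteq> F \<Longrightarrow> (\<lambda>k. osc J (linear_points (\<lambda>j. wt (e j)) J P k)) \<longlonglongrightarrow> 0"
  shows "\<exists>s0\<ge>1. \<forall>e. range e \<subseteq> F \<longrightarrow> (\<exists>s. 1 \<le> s \<and> s \<le> s0 \<and> contracting (\<lambda>j. wt (e j)) J s)"
proof (rule ccontr)
  define good where "good s0 \<longleftrightarrow> (\<forall>e. range e \<subseteq> F \<longrightarrow>
    (\<exists>s. 1 \<le> s \<and> s \<le> s0 \<and> contracting (\<lambda>j. wt (e j)) J s))" for s0
  assume "\<not> ?thesis"
  then have no: "\<not> good (Suc s0)" for s0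
    unfolding good_def[symmetric] by simp
  let ?R = "\<lambda>e s. s \<ge> 1 \<longrightarrow> \<not> contracting (\<lambda>j. wt (e j)) J s"
  have "\<exists>e. range e \<subseteq> F \<and> (\<forall>s. ?R e s)"
  proof (rule infinite_branch[OF F])
    fix e f :: "nat \<Rightarrow> 'e" and s
    assume "\<And>i. i < s \<Longrightarrow> e i = f i" "?R e s"
    then show "?R f s"
      using linear_points_cong[of s "\<lambda>j. wt (e j)" "\<lambda>j. wt (f j)" J] by (simp add: contracting_def)
  next
    fix s0
    obtain e where e: "range e \<subseteq> F"
      "\<And>s. 1 \<le> s \<Longrightarrow> s \<le> Suc s0 \<Longrightarrow> \<not> contracting (\<lambda>j. wt (e j)) J s"
      using no[of s0] unfolding good_def by auto
    show "\<exists>e. range e \<subseteq> F \<and> (\<forall>s\<le>s0. ?R e s)"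
      using e by (intro exI[of _ e]) auto
  qed
  then obtain e where e: "range e \<subseteq> F" "\<And>s. ?R e s" by blast
  have "\<exists>s\<ge>1. contracting (\<lambda>j. wt (e j)) J s"
    using e(1) by (intro eventually_contracting[OF J _ lim, where B = B] wt) auto
  then show False using e(2) by blast
qed

subsection \<open>PN refinement as a perturbation of linear refinement\<close>

text \<open>A rank-one map with values on the line of \<open>X1\<close>, so differences with a
  common \<open>X1\<close> reduce to differences of scalars.\<close>

lemma A_mat_mult_vec: "A_mat X1 X2 *v v = (inner (X1 + X2) v / inner (X1 + X2) X1) *\<^sub>R X1"
proof (rule Finite_Cartesian_Product.vec_eq_iff[THEN iffD2, rule_format])
  fix i
  show "(A_mat X1 X2 *v v) $ i = ((inner (X1 + X2) v / inner (X1 + X2) X1) *\<^sub>R X1) $ i"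
    by (simp add: A_mat_def matrix_vector_mult_def matrix_matrix_mult_def columnvector_def
      rowvector_def inner_vec_def sum_distrib_left sum_distrib_right sum_divide_distrib UNIV_1 mult_ac)
qed

lemma unit_inner_eq:
  assumes "norm X = 1" "norm Y = 1"
  shows "inner X Y = 1 - (norm (X - Y))\<^sup>2 / 2"
  using assms by (simp add: norm_eq_1 power2_norm_eq_inner inner_diff inner_commute diff_divide_distrib algebra_simps)

text \<open>The denominators \<open>inner (X + U) X = 2 - (norm (X - U))\<^sup>2 / 2\<close> lie
  between 1 and 2 for unit vectors at distance at most 1, so no quotient can blow up.\<close>

lemma A_mat_lipschitz:
  assumes X: "norm X = 1" and Y: "norm Y = 1" "norm (X - Y) \<le> 1" and Z: "norm Z = 1" "norm (X - Z) \<le> 1"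
  shows "norm ((A_mat X Y - A_mat X Z) *v v) \<le> 4 * norm (Y - Z) * norm v"
proof -
  have den: "1 \<le> inner (X + U) X" "inner (X + U) X \<le> 2" if "norm U = 1" "norm (X - U) \<le> 1" for U
  proof -
    have "inner X X = 1" using X by (simp add: norm_eq_sqrt_inner)
    then have "inner (X + U) X = 2 - (norm (X - U))\<^sup>2 / 2"
      using unit_inner_eq[OF X that(1)] by (simp add: inner_add_left inner_commute[of U X])
    moreover have "(norm (X - U))\<^sup>2 \<le> 1\<^sup>2" using that by (intro power_mono) auto
    ultimately show "1 \<le> inner (X + U) X" "inner (X + U) X \<le> 2" by auto
  qed
  let ?p = "inner (X + Y) X" and ?q = "inner (X + Z) X"
  have p: "1 \<le> ?p" "?p \<le> 2" and q: "1 \<le> ?q" "?q \<le> 2" using den Y Z by auto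
  have pq: "1 * 1 \<le> ?p * ?q" using p q by (intro mult_mono) auto
  \<comment> \<open>The cross term \<open>inner (X + Z) v * ?q\<close> is added and subtracted, so
    that every summand contains \<open>Y - Z\<close> up to sign.\<close>
  let ?num = "inner (Y - Z) v * ?q + inner (X + Z) v * inner (Z - Y) X"
  have "(A_mat X Y - A_mat X Z) *v v = (inner (X + Y) v / ?p - inner (X + Z) v / ?q) *\<^sub>R X"
    by (simp add: matrix_vector_mult_diff_rdistrib A_mat_mult_vec scaleR_left_diff_distrib)
  also have "inner (X + Y) v / ?p - inner (X + Z) v / ?q = ?num / (?p * ?q)"
    using p q by (simp add: divide_simps) (simp add: inner_add_left inner_diff_left algebra_simps)
  finally have "norm ((A_mat X Y - A_mat X Z) *v v) = \<bar>?num\<bar> / (?p * ?q)"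
    using X p q abs_of_pos[of ?p] abs_of_pos[of ?q] by (simp add: abs_mult)
  also have "\<dots> \<le> \<bar>?num\<bar> / 1" using pq by (intro divide_left_mono) auto
  also have "\<bar>?num\<bar> \<le> \<bar>inner (Y - Z) v\<bar> * \<bar>?q\<bar> + \<bar>inner (X + Z) v\<bar> * \<bar>inner (Z - Y) X\<bar>"
    using abs_triangle_ineq[of "inner (Y - Z) v * ?q" "inner (X + Z) v * inner (Z - Y) X"]
    by (simp add: abs_mult)
  also have "\<dots> \<le> (norm (Y - Z) * norm v) * 2 + (2 * norm v) * norm (Y - Z)"
  proof (intro add_mono mult_mono)
    show "\<bar>inner (Y - Z) v\<bar> \<le> norm (Y - Z) * norm v" by (rule Cauchy_Schwarz_ineq2)
    have "norm (X + Z) \<le> 2" using norm_triangle_ineq[of X Z] X Z by simp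
    then show "\<bar>inner (X + Z) v\<bar> \<le> 2 * norm v"
      using Cauchy_Schwarz_ineq2[of "X + Z" v] by (meson mult_right_mono norm_ge_zero order_trans)
    show "\<bar>inner (Z - Y) X\<bar> \<le> norm (Y - Z)"
      using Cauchy_Schwarz_ineq2[of "Z - Y" X] X by (simp add: norm_minus_commute)
  qed (use q in auto)
  finally show ?thesis by (simp add: mult_ac)
qed

text \<open>For unit vectors \<open>inner X (Y - X) = - (norm (Y - X))\<^sup>2 / 2\<close>, so averaging unit normals changes
  the length only to second order.\<close>

lemma refined_normal_perturbation:
  assumes J: "finite J" and b: "unit_weights b J B" and B: "1 \<le> B"
    and N: "\<And>j. j \<in> J \<Longrightarrow> norm (N j) = 1" and small: "osc J N \<le> 1 / (4 * B\<^sup>2)" and i: "i \<in> J"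
  shows "norm (refined_normal b J N i) = 1"
    and "norm (refined_normal b J N i - (\<Sum>j\<in>J. b i j *\<^sub>R N j)) \<le> 2 * B\<^sup>2 * (osc J N)\<^sup>2"
proof -
  let ?d = "osc J N"
  define Y where "Y = (\<Sum>j\<in>J. b i j *\<^sub>R N j)"
  have d: "0 \<le> ?d" by (rule osc_nonneg)
  have B2: "1 \<le> B\<^sup>2" "B \<le> B\<^sup>2" using B by (auto simp: power2_eq_square mult_ge1_I)
  have rs: "(\<Sum>j\<in>J. b i j) = 1" "(\<Sum>j\<in>J. \<bar>b i j\<bar>) \<le> B"
    using b i by (auto simp: unit_weights_def)
  have inn: "\<bar>inner (N i) Y - 1\<bar> \<le> B * ?d\<^sup>2 / 2"
  proof -
    have "inner (N i) Y - 1 = (\<Sum>j\<in>J. b i j *\<^sub>R inner (N i) (N j)) - 1"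
      by (simp add: Y_def inner_sum_right)
    moreover have "norm ((\<Sum>j\<in>J. b i j *\<^sub>R inner (N i) (N j)) - 1) \<le> B * (?d\<^sup>2 / 2)"
    proof (rule norm_weighted_sum_diff_le[OF rs])
      fix j assume j: "j \<in> J"
      have "(norm (N i - N j))\<^sup>2 \<le> ?d\<^sup>2"
        using norm_diff_le_osc[OF J i j] by (intro power_mono) auto
      then show "norm (inner (N i) (N j) - 1) \<le> ?d\<^sup>2 / 2"
        using unit_inner_eq[OF N[OF i] N[OF j]] by simp
    qed simp
    ultimately show ?thesis by simp
  qed
  have YN: "norm (Y - N i) \<le> B * ?d"
    unfolding Y_def using norm_diff_le_osc[OF J _ i] d by (intro norm_weighted_sum_diff_le[OF rs]) auto
  then have "(norm (Y - N i))\<^sup>2 \<le> B\<^sup>2 * ?d\<^sup>2"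
    using power_mono[of _ _ 2] by (fastforce simp: power_mult_distrib)
  \<comment> \<open>Both terms on the right are of second order in the oscillation: the first by the
    bound on \<open>inner (N i) Y\<close>, the second as a square.\<close>
  moreover have "(norm Y)\<^sup>2 - 1 = 2 * (inner (N i) Y - 1) + (norm (Y - N i))\<^sup>2"
    using N[OF i] by (simp add: power2_norm_eq_inner norm_eq_1 inner_diff inner_commute algebra_simps)
  moreover have "B * ?d\<^sup>2 \<le> B\<^sup>2 * ?d\<^sup>2" using B2 by (intro mult_right_mono) auto
  moreover have "\<bar>q\<bar> \<le> 2 * v"
    if "\<bar>p\<bar> \<le> u / 2" "z \<le> v" "q = 2 * p + z" "u \<le> v" "0 \<le> z" for p q u v z :: real
    using that by linarith
  ultimately have "\<bar>(norm Y)\<^sup>2 - 1\<bar> \<le> 2 * (B\<^sup>2 * ?d\<^sup>2)"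
    using inn zero_le_power2 by blast
  then have sq: "\<bar>(norm Y)\<^sup>2 - 1\<bar> \<le> 2 * B\<^sup>2 * ?d\<^sup>2" by (simp only: mult.assoc)
  have "\<bar>norm Y - 1\<bar> * 1 \<le> \<bar>norm Y - 1\<bar> * (norm Y + 1)"
    by (intro mult_left_mono) auto
  also have "\<dots> = \<bar>(norm Y - 1) * (norm Y + 1)\<bar>" by (simp add: abs_mult)
  also have "(norm Y - 1) * (norm Y + 1) = (norm Y)\<^sup>2 - 1"
    by (simp add: power2_eq_square algebra_simps)
  finally have nY: "\<bar>norm Y - 1\<bar> \<le> 2 * B\<^sup>2 * ?d\<^sup>2" using sq by simp
  have dB: "4 * B\<^sup>2 * ?d \<le> 1" 
    using small B2 pos_le_divide_eq[of "4 * B\<^sup>2" ?d 1] by (simp only: mult.commute)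
  have "?d * 1 \<le> ?d * (4 * B\<^sup>2)" using d B2 by (intro mult_left_mono) auto
  then have "?d \<le> 1" using dB by (simp add: mult.commute)
  \<comment> \<open>Hence \<open>norm Y\<close> differs from 1 by at most 1/2, and the average can
    be normalized.\<close>
  then have "(4 * B\<^sup>2 * ?d) * ?d \<le> 1 * 1"
    using dB d by (intro mult_mono) auto
  then have "Y \<noteq> 0" using nY by (auto simp: power2_eq_square algebra_simps)
  have ref: "refined_normal b J N i = Y /\<^sub>R norm Y" by (simp add: refined_normal_def Y_def)
  show "norm (refined_normal b J N i) = 1" using \<open>Y \<noteq> 0\<close> by (simp add: ref)
  have "Y /\<^sub>R norm Y - Y = ((1 - norm Y) / norm Y) *\<^sub>R Y"
    using \<open>Y \<noteq> 0\<close> by (simp only: diff_divide_distrib scaleR_left_diff_distrib) (simp add: divide_inverse)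
  then have "norm (Y /\<^sub>R norm Y - Y) = \<bar>norm Y - 1\<bar>" using \<open>Y \<noteq> 0\<close> by simp
  then show "norm (refined_normal b J N i - (\<Sum>j\<in>J. b i j *\<^sub>R N j)) \<le> 2 * B\<^sup>2 * (osc J N)\<^sup>2"
    using nY by (simp add: ref Y_def)
qed

lemma matrix_vector_mult_sum_left: "(\<Sum>l\<in>J. M l) *v (v :: real ^ 'n) = (\<Sum>l\<in>J. M l *v v)"
  by (induction J rule: infinite_finite_induct) (auto simp: matrix_vector_mult_add_rdistrib)

text \<open>The antisymmetry of \<open>A\<^sub>i\<^sub>j - A\<^sub>i\<^sub>l\<close> in \<open>j, l\<close> makes the block row sums equal to the identity,
  so the perturbation annihilates constants.\<close>

lemma pn_step_perturbation:
  assumes J: "finite J" and b: "unit_weights b J B" and B: "1 \<le> B"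
    and N: "\<And>j. j \<in> J \<Longrightarrow> norm (N j) = 1" and small: "osc J N \<le> 1 / (4 * B\<^sup>2)" and i: "i \<in> J"
  shows "norm (pn_step b J N P i - (\<Sum>j\<in>J. b i j *\<^sub>R P j)) \<le> 4 * B\<^sup>2 * osc J N * osc J P"
proof -
  let ?d = "osc J N"
  define X where "X = refined_normal b J N i"
  have d: "0 \<le> ?d" by (rule osc_nonneg)
  have B2: "1 \<le> B\<^sup>2" "B \<le> B\<^sup>2" using B by (auto simp: power2_eq_square mult_ge1_I)
  have rs: "(\<Sum>j\<in>J. b i j) = 1" "(\<Sum>j\<in>J. \<bar>b i j\<bar>) \<le> B"
    using b i by (auto simp: unit_weights_def)
  have X: "norm X = 1" "norm (X - (\<Sum>j\<in>J. b i j *\<^sub>R N j)) \<le> 2 * B\<^sup>2 * ?d\<^sup>2"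
    using refined_normal_perturbation[OF assms] by (auto simp: X_def)
  have dB: "4 * B\<^sup>2 * ?d \<le> 1" 
    using small B2 pos_le_divide_eq[of "4 * B\<^sup>2" ?d 1] by (simp only: mult.commute)
  have "?d * 1 \<le> ?d * (4 * B\<^sup>2)" using d B2 by (intro mult_left_mono) auto
  then have d1: "?d \<le> 1" using dB by (simp add: mult.commute)
  \<comment> \<open>This closeness is what \<open>A_mat_lipschitz\<close> asks for; the second-order
    term is absorbed by \<open>?d \<le> 1\<close>.\<close>
  have near: "norm (X - N j) \<le> 1" if j: "j \<in> J" for j
  proof -
    have "norm ((\<Sum>j\<in>J. b i j *\<^sub>R N j) - N j) \<le> B * ?d"
      using norm_diff_le_osc[OF J _ j] d by (intro norm_weighted_sum_diff_le[OF rs]) auto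
    then have "norm (X - N j) \<le> 2 * B\<^sup>2 * ?d\<^sup>2 + B * ?d"
      using X(2) norm_triangle_ineq[of "X - (\<Sum>j\<in>J. b i j *\<^sub>R N j)" "(\<Sum>j\<in>J. b i j *\<^sub>R N j) - N j"] by simp
    also have "\<dots> \<le> 2 * B\<^sup>2 * ?d + B\<^sup>2 * ?d"
      using B2 d d1 by (intro add_mono mult_mono) (auto simp: power2_eq_square mult_left_le)
    also have "\<dots> \<le> 4 * B\<^sup>2 * ?d" using d B2 by simp
    finally show ?thesis using dB by linarith
  qed
  let ?A = "\<lambda>j. A_mat X (N j)"
  \<comment> \<open>The deviation of the PN step from the linear step, as a linear map of the points
    \<open>v\<close>.\<close>
  let ?D = "\<lambda>v. \<Sum>j\<in>J. \<Sum>l\<in>J. (b i j * b i l) *\<^sub>R ((?A j - ?A l) *v v j)"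
  have "(b i j *\<^sub>R M_mat b J N i j) *v P j = b i j *\<^sub>R P j +
      (\<Sum>l\<in>J. (b i j * b i l) *\<^sub>R ((?A j - ?A l) *v P j))" for j
  proof -
    have "(b i j *\<^sub>R M_mat b J N i j) *v P j = b i j *\<^sub>R (M_mat b J N i j *v P j)"
      by (rule scaleR_matrix_vector_assoc[symmetric])
    also have "M_mat b J N i j *v P j = P j + (\<Sum>l\<in>J. b i l *\<^sub>R ((?A j - ?A l) *v P j))"
      unfolding M_mat_def X_def matrix_vector_mult_add_rdistrib matrix_vector_mult_sum_left
        scaleR_matrix_vector_assoc by simp
    finally show ?thesis by (simp only: scaleR_add_right scaleR_sum_right scaleR_scaleR)
  qed
  then have "pn_step b J N P i = (\<Sum>j\<in>J. b i j *\<^sub>R P j) + ?D P"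
    by (simp only: pn_step_def sum.distrib)
  moreover have "?D P = ?D (\<lambda>j. P j - P i)"
  proof -
    have "?D (\<lambda>_. P i) = (\<Sum>l\<in>J. \<Sum>j\<in>J. (b i j * b i l) *\<^sub>R ((?A j - ?A l) *v P i))" by (rule sum.swap)
    also have "\<dots> = - ?D (\<lambda>_. P i)"
      by (simp add: matrix_vector_mult_diff_rdistrib scaleR_diff_right mult.commute flip: sum_negf)
    finally have "?D (\<lambda>_. P i) = - ?D (\<lambda>_. P i)" .
    moreover have "v = - v \<Longrightarrow> v = 0" for v :: "real ^ 3"
      by (simp add: Finite_Cartesian_Product.vec_eq_iff)
    ultimately have "?D (\<lambda>_. P i) = 0" by blast
    then show ?thesis
      by (simp only: matrix_vector_mult_diff_distrib scaleR_diff_right sum_subtractf diff_zero)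
  qed
  moreover have "norm (?D (\<lambda>j. P j - P i)) \<le> B\<^sup>2 * (4 * ?d * osc J P)"
  proof -
    have "norm (?D (\<lambda>j. P j - P i)) \<le> (\<Sum>j\<in>J. \<Sum>l\<in>J. \<bar>b i j\<bar> * \<bar>b i l\<bar> * (4 * ?d * osc J P))"
    proof (intro order_trans[OF norm_sum] sum_mono)
      fix j l assume jl: "j \<in> J" "l \<in> J"
      have "norm ((?A j - ?A l) *v (P j - P i)) \<le> 4 * norm (N j - N l) * norm (P j - P i)"
        using jl N near X(1) by (intro A_mat_lipschitz) auto
      also have "\<dots> \<le> 4 * ?d * osc J P"
        using norm_diff_le_osc[OF J jl, of N] norm_diff_le_osc[OF J jl(1) i, of P] d by (intro mult_mono) auto
      finally show "norm ((b i j * b i l) *\<^sub>R ((?A j - ?A l) *v (P j - P i)))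
          \<le> \<bar>b i j\<bar> * \<bar>b i l\<bar> * (4 * ?d * osc J P)"
        by (simp add: abs_mult mult_left_mono)
    qed
    also have "\<dots> = (\<Sum>j\<in>J. \<bar>b i j\<bar>)\<^sup>2 * (4 * ?d * osc J P)"
      by (simp only: power2_eq_square sum_product) (simp only: sum_distrib_right)
    also have "\<dots> \<le> B\<^sup>2 * (4 * ?d * osc J P)"
      using rs d osc_nonneg[of J P] by (intro mult_right_mono power_mono) (auto intro: sum_nonneg)
    finally show ?thesis .
  qed
  ultimately show ?thesis by (simp add: mult_ac)
qed

subsection \<open>The spectrum of the subdivision matrix on differences\<close>

text \<open>The matrix acting on the differences \<open>q\<^sub>i - q\<^sub>0\<close>, \<open>i \<ge> 1\<close>.\<close>

definition deflated_matrix :: "nat \<Rightarrow> 'a :: comm_ring_1 mat \<Rightarrow> 'a mat" where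
  "deflated_matrix L A = Matrix.mat L L (\<lambda>(i, j). A $$ (Suc i, Suc j) - A $$ (0, Suc j))"

text \<open>In the basis of the constant vector and the unit vectors with index 1 to
  \<open>L\<close> the matrix becomes block triangular: the constant vector is an eigenvector for 1,
  and the other diagonal block acts on differences to entry 0.\<close>

lemma char_poly_unit_row_sums:
  fixes A :: "'a :: field mat"
  assumes A: "A \<in> carrier_mat (Suc L) (Suc L)"
    and rs: "\<And>i. i < Suc L \<Longrightarrow> (\<Sum>j<Suc L. A $$ (i, j)) = 1"
  shows "char_poly A = [:- 1, 1:] * char_poly (deflated_matrix L A)"
proof -
  let ?n = "Suc L"
  \<comment> \<open>The columns of \<open>P\<close> are that basis, \<open>R\<close> is its inverse,
    and \<open>T\<close> is \<open>A\<close> in the new basis.\<close>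
  define P :: "'a mat" where "P = Matrix.mat ?n ?n (\<lambda>(i, j). if j = 0 \<or> i = j then 1 else 0)"
  define R :: "'a mat" where
    "R = Matrix.mat ?n ?n (\<lambda>(i, j). if i = j then 1 else if j = 0 then - 1 else 0)"
  define T :: "'a mat" where
    "T = Matrix.mat ?n ?n (\<lambda>(i, j). if i = 0 then (if j = 0 then 1 else A $$ (0, j))
       else (if j = 0 then 0 else A $$ (i, j) - A $$ (0, j)))"
  define e1 :: "'a mat" where "e1 = Matrix.mat 1 1 (\<lambda>_. 1)"
  define e2 :: "'a mat" where "e2 = Matrix.mat 1 L (\<lambda>(i, j). A $$ (0, Suc j))"
  have PX: "(P * X) $$ (i, j) = X $$ (0, j) + (if i = 0 then 0 else X $$ (i, j))"
    if X: "X \<in> carrier_mat ?n ?n" and ij: "i < ?n" "j < ?n" for X i j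
  proof -
    have "(P * X) $$ (i, j) = (\<Sum>k<?n. P $$ (i, k) * X $$ (k, j))"
      using X ij by (auto simp: P_def scalar_prod_def atLeast0LessThan intro!: sum.cong)
    also have "\<dots> = (\<Sum>k<?n. (if k = 0 then X $$ (0, j) else 0)
        + (if k = i then (if i = 0 then 0 else X $$ (i, j)) else 0))"
      using ij by (intro sum.cong) (auto simp: P_def)
    also have "\<dots> = X $$ (0, j) + (if i = 0 then 0 else X $$ (i, j))"
      using ij by (simp only: sum.distrib sum.delta finite_lessThan) auto
    finally show ?thesis .
  qed
  have PR: "P * R = 1\<^sub>m ?n"
  proof (rule eq_matI)
    fix i j assume "i < dim_row (1\<^sub>m ?n :: 'a mat)" "j < dim_col (1\<^sub>m ?n :: 'a mat)"
    then show "(P * R) $$ (i, j) = 1\<^sub>m ?n $$ (i, j)"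
      by (subst PX) (auto simp: R_def)
  qed (auto simp: P_def R_def)
  have carr: "P \<in> carrier_mat ?n ?n" "R \<in> carrier_mat ?n ?n" "T \<in> carrier_mat ?n ?n"
    by (auto simp: P_def R_def T_def)
  have RP: "R * P = 1\<^sub>m ?n"
    using mat_mult_left_right_inverse[OF carr(1,2) PR] .
  have AP: "A * P = P * T"
  proof (rule eq_matI)
    fix i j assume ij: "i < dim_row (P * T)" "j < dim_col (P * T)"
    then have ij: "i < ?n" "j < ?n" by (auto simp: P_def T_def)
    have "(A * P) $$ (i, j) = (\<Sum>k<?n. A $$ (i, k) * P $$ (k, j))"
      using A ij by (auto simp: P_def scalar_prod_def atLeast0LessThan intro!: sum.cong)
    also have "\<dots> = (\<Sum>k<?n. if j = 0 then A $$ (i, k) else if k = j then A $$ (i, j) else 0)"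
      using ij by (intro sum.cong) (auto simp: P_def)
    also have "\<dots> = (if j = 0 then 1 else A $$ (i, j))"
      using ij rs[of i] by (cases "j = 0") (auto simp del: sum.lessThan_Suc)
    also have "\<dots> = (P * T) $$ (i, j)"
      using ij by (subst PX) (auto simp: T_def)
    finally show "(A * P) $$ (i, j) = (P * T) $$ (i, j)" .
  qed (use A in \<open>auto simp: P_def T_def\<close>)
  have "A = A * (P * R)" using A PR by simp
  also have "\<dots> = P * T * R" using A carr AP by (metis assoc_mult_mat)
  finally have "similar_mat_wit A T P R"
    using A carr PR RP by (intro similar_mat_witI[of _ _ ?n]) auto
  then have "char_poly A = char_poly T"
    by (intro char_poly_similar) (auto simp: similar_mat_def)
  also have "T = four_block_mat e1 e2 (0\<^sub>m L 1) (deflated_matrix L A)"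
    by (rule eq_matI) (auto simp: T_def e1_def e2_def deflated_matrix_def)
  also have "char_poly \<dots> = char_poly e1 * char_poly (deflated_matrix L A)"
    by (rule char_poly_four_block_zeros_col) (auto simp: e1_def e2_def deflated_matrix_def)
  also have "char_poly e1 = [:- 1, 1:]"
    by (simp add: e1_def char_poly_defs det_def sign_def)
  finally show ?thesis .
qed

text \<open>Removing one eigenvalue 1 leaves the eigenvalues \<open>tl ls\<close>, all of modulus at
  most \<open>lam < 1\<close>. After division by a larger \<open>\<rho>\<close> the spectral radius
  is below 1, so the powers are bounded. The rate is the same for all \<open>d\<close>; only the
  constant depends on \<open>d\<close>.\<close>

lemma standard_deflated_geometric:
  assumes S: "S \<in> carrier_mat (Suc L) (Suc L)"
    and rs: "unit_row_sums S" and std: "standard_matrix S"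
  obtains \<rho> :: real where "0 < \<rho>" "\<rho> < 1"
    "\<And>d :: nat \<Rightarrow> nat \<Rightarrow> real. (\<And>k i. i < L \<Longrightarrow> d (Suc k) i = (\<Sum>j<L. deflated_matrix L S $$ (i, j) * d k j))
      \<Longrightarrow> \<exists>c. \<forall>k. \<forall>i<L. \<bar>d k i\<bar> \<le> c * \<rho> ^ k"
proof -
  let ?h = "complex_of_real"
  let ?C = "deflated_matrix L (map_mat ?h S)"
  from std obtain ls lam where ls: "char_poly (map_mat ?h S) = (\<Prod>l\<leftarrow>ls. [:- l, 1:])"
    and len: "4 \<le> length ls" and ls0: "ls ! 0 = 1" and lam: "lam < 1"
    and ls1: "ls ! 1 = ?h lam" and ls2: "ls ! 2 = ?h lam" and ls3: "cmod (ls ! 3) < lam"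
    and lsm: "\<And>i j. 3 \<le> i \<Longrightarrow> i \<le> j \<Longrightarrow> j < length ls \<Longrightarrow> cmod (ls ! i) \<ge> cmod (ls ! j)"
    unfolding standard_matrix_def by blast
  have lam0: "0 < lam" using ls3 norm_ge_zero[of "ls ! 3"] by linarith
  have tl_le: "cmod l \<le> lam" if l: "l \<in> set (tl ls)" for l
  proof -
    obtain i where i: "i < length (tl ls)" "l = tl ls ! i" using l by (metis in_set_conv_nth)
    then have "l = ls ! Suc i" "Suc i < length ls" by (auto simp: nth_tl)
    moreover have "i = 0 \<or> i = 1 \<or> 3 \<le> Suc i" by linarith
    ultimately show ?thesis
      using lsm[of 3 "Suc i"] ls1 ls2 ls3 lam0 by (auto simp: numeral_2_eq_2)
  qed
  have cp: "char_poly (map_mat ?h S) = [:- 1, 1:] * char_poly ?C"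
  proof (rule char_poly_unit_row_sums)
    show "map_mat ?h S \<in> carrier_mat (Suc L) (Suc L)" using S by simp
    fix i assume i: "i < Suc L"
    have "(\<Sum>j<Suc L. map_mat ?h S $$ (i, j)) = ?h (\<Sum>j<Suc L. S $$ (i, j))"
      using S i by (simp del: sum.lessThan_Suc)
    then show "(\<Sum>j<Suc L. map_mat ?h S $$ (i, j)) = 1"
      using rs S i unfolding unit_row_sums_def by (metis carrier_matD of_real_1)
  qed
  have "ls = 1 # tl ls" using len ls0 by (cases ls) auto
  then have "(\<Prod>l\<leftarrow>ls. [:- l, 1:]) = [:- 1, 1:] * (\<Prod>l\<leftarrow>tl ls. [:- l, 1:])"
    by (metis list.simps(9) prod_list.Cons)
  then have cpC: "char_poly ?C = (\<Prod>l\<leftarrow>tl ls. [:- l, 1:])"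
    using cp ls by (metis mult_cancel_left pCons_eq_0_iff zero_neq_one)
  \<comment> \<open>Strictly above \<open>lam\<close>, because at the rate \<open>lam\<close> itself
    Jordan blocks could contribute polynomial factors.\<close>
  define \<rho> where "\<rho> = (lam + 1) / 2"
  have \<rho>: "lam < \<rho>" "0 < \<rho>" "\<rho> < 1" using lam lam0 by (auto simp: \<rho>_def)
  have C: "?C \<in> carrier_mat L L" by (simp add: deflated_matrix_def)
  define B where "B = (1 / ?h \<rho>) \<cdot>\<^sub>m ?C"
  have B: "B \<in> carrier_mat L L" using C by (simp add: B_def)
  \<comment> \<open>At least three eigenvalues remain; a positive dimension is needed for the
    spectral radius to be attained.\<close>
  have L: "L > 0"
  proof (rule ccontr)
    assume "\<not> L > 0"
    then have "degree (char_poly ?C) = 0" using degree_monic_char_poly[OF C] by simp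
    moreover have "degree (char_poly ?C) = length (tl ls)"
      unfolding cpC by (rule degree_linear_factors)
    ultimately show False using len by simp
  qed
  have evB: "cmod \<mu> < 1" if ev: "eigenvalue B \<mu>" for \<mu>
  proof -
    obtain v where v: "v \<in> carrier_vec L" "v \<noteq> 0\<^sub>v L" "B *\<^sub>v v = \<mu> \<cdot>\<^sub>v v"
      using ev B by (auto simp: eigenvalue_def eigenvector_def)
    have "?C = ?h \<rho> \<cdot>\<^sub>m B" using \<rho> by (intro eq_matI) (auto simp: B_def)
    then have "?C *\<^sub>v v = ?h \<rho> \<cdot>\<^sub>v (B *\<^sub>v v)"
      using B v(1) by (simp only:) (intro eq_vecI; auto)
    then have "eigenvalue ?C (?h \<rho> * \<mu>)"
      using v C by (auto simp: eigenvalue_def eigenvector_def smult_smult_assoc intro!: exI[of _ v])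
    then have "poly (\<Prod>l\<leftarrow>tl ls. [:- l, 1:]) (?h \<rho> * \<mu>) = 0"
      using eigenvalue_root_char_poly[OF C] cpC by simp
    then have "?h \<rho> * \<mu> \<in> set (tl ls)"
      by (auto simp: poly_prod_list prod_list_zero_iff)
    then have "\<rho> * cmod \<mu> \<le> lam" using tl_le[of "?h \<rho> * \<mu>"] \<rho> by (simp add: norm_mult)
    then have "\<rho> * cmod \<mu> < \<rho> * 1" using \<rho> by linarith
    then show ?thesis using \<rho> mult_less_cancel_left_pos by blast
  qed
  have "spectral_radius B < 1"
    using spectral_radius_mem_max(1)[OF B L] evB by (auto simp: spectrum_def)
  from spectral_radius_jnf_norm_bound_less_1_upper_triangular[OF B this]
  obtain c where c: "\<And>k. norm_bound (B ^\<^sub>m k) c" by blast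
  show ?thesis
  proof (rule that[OF \<rho>(2,3)])
    fix d :: "nat \<Rightarrow> nat \<Rightarrow> real"
    assume d: "\<And>k i. i < L \<Longrightarrow> d (Suc k) i = (\<Sum>j<L. deflated_matrix L S $$ (i, j) * d k j)"
    \<comment> \<open>Rescaling by \<open>\<rho> ^ k\<close> turns the recursion into powers of
      \<open>B\<close>, whose entries are bounded.\<close>
    let ?v = "\<lambda>k. Matrix.vec L (\<lambda>i. ?h (d k i / \<rho> ^ k))"
    have step: "?v (Suc k) = B *\<^sub>v ?v k" for k
    proof (rule eq_vecI)
      fix i assume "i < dim_vec (B *\<^sub>v ?v k)"
      then have i: "i < L" using B by simp
      have "vec_index (B *\<^sub>v ?v k) i = (\<Sum>j<L. (1 / ?h \<rho>) * ?C $$ (i, j) * ?h (d k j / \<rho> ^ k))"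
        using i B C by (auto simp: scalar_prod_def B_def atLeast0LessThan intro!: sum.cong)
      also have "\<dots> = (\<Sum>j<L. ?h (deflated_matrix L S $$ (i, j) * d k j / \<rho> ^ Suc k))"
        using i S by (intro sum.cong) (auto simp: deflated_matrix_def divide_simps)
      also have "\<dots> = vec_index (?v (Suc k)) i"
        using i d[of i k] by (simp flip: of_real_sum add: sum_divide_distrib del: of_real_divide of_real_mult of_real_power power_Suc)
      finally show "vec_index (?v (Suc k)) i = vec_index (B *\<^sub>v ?v k) i" by simp
    qed (use B in auto)
    have vk: "?v k = (B ^\<^sub>m k) *\<^sub>v ?v 0" for k
    proof (induction k)
      case 0 then show ?case using B by auto
    next
      case (Suc k)
      have "B * (B ^\<^sub>m k) = (B ^\<^sub>m k) * B"
        using B by (induction k) (auto simp flip: assoc_mult_mat[of B L L _ L _ L])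
      then show ?case unfolding step Suc.IH pow_mat.simps using B
        by (metis assoc_mult_mat_vec pow_carrier_mat vec_carrier)
    qed
    have "\<bar>d k i\<bar> \<le> (c * (\<Sum>j<L. \<bar>d 0 j\<bar>)) * \<rho> ^ k" if i: "i < L" for k i
    proof -
      have "?h (d k i / \<rho> ^ k) = vec_index ((B ^\<^sub>m k) *\<^sub>v ?v 0) i" using i vk[of k] by (metis index_vec)
      also have "\<dots> = (\<Sum>j<L. (B ^\<^sub>m k) $$ (i, j) * ?h (d 0 j))"
        using i B by (auto simp: scalar_prod_def atLeast0LessThan intro!: sum.cong)
      finally have "\<bar>d k i / \<rho> ^ k\<bar> = cmod (\<Sum>j<L. (B ^\<^sub>m k) $$ (i, j) * ?h (d 0 j))"
        by (metis norm_of_real real_norm_def)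
      also have "\<dots> \<le> (\<Sum>j<L. c * \<bar>d 0 j\<bar>)"
      proof (intro order_trans[OF norm_sum] sum_mono)
        fix j assume "j \<in> {..<L}"
        then have "cmod ((B ^\<^sub>m k) $$ (i, j)) \<le> c" using c[of k] i B by (simp add: norm_bound_def)
        then show "cmod ((B ^\<^sub>m k) $$ (i, j) * ?h (d 0 j)) \<le> c * \<bar>d 0 j\<bar>"
          by (simp add: norm_mult mult_right_mono)
      qed
      finally show ?thesis using \<rho> by (simp add: sum_distrib_left field_simps)
    qed
    then show "\<exists>c. \<forall>k. \<forall>i<L. \<bar>d k i\<bar> \<le> c * \<rho> ^ k" by blast
  qed
qed

subsection \<open>Stability of PN subdivision\<close>

text \<open>A bootstrap on the normals: while their oscillation is small, normalization is a
  relative error of at most \<open>\<eta>\<close>, and the summed bound keeps the oscillation small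
  at the next level. Such normals make the PN step a perturbation of relative size
  \<open>\<eta>\<close> too, and the displacement of a point telescopes into the sum of the
  oscillations.\<close>

lemma pn_points_stable:
  fixes J :: "'i set"
  assumes J: "finite J" "J \<noteq> {}" and s0: "1 \<le> s0" and B: "1 \<le> B"
  obtains \<delta> K :: real where "0 < \<delta>" "0 < K"
    "\<And>w N P n. (\<And>k. unit_weights (w k) J B) \<Longrightarrow>
       (\<And>k. \<exists>s. 1 \<le> s \<and> s \<le> s0 \<and> contracting (\<lambda>t. w (k + t)) J s) \<Longrightarrow>
       (\<And>j. j \<in> J \<Longrightarrow> norm (N j) = 1) \<Longrightarrow> osc J N \<le> \<delta> \<Longrightarrow>
       (\<Sum>k\<le>n. osc J (pn_points w J N P k)) \<le> K * osc J P \<and>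
       (\<forall>i\<in>J. norm (pn_points w J N P n i - P i) \<le> K * osc J P)"
proof -
  obtain \<eta> K :: real where \<eta>: "0 < \<eta>" "\<eta> \<le> 1" and K: "0 < K"
    and sum_osc: "\<And>w (X :: nat \<Rightarrow> 'i \<Rightarrow> real ^ 3) n. (\<And>k. unit_weights (w k) J B) \<Longrightarrow>
       (\<And>k. \<exists>s. 1 \<le> s \<and> s \<le> s0 \<and> contracting (\<lambda>t. w (k + t)) J s) \<Longrightarrow>
       (\<And>k i. k < n \<Longrightarrow> i \<in> J \<Longrightarrow>
          norm (X (Suc k) i - (\<Sum>j\<in>J. w k i j *\<^sub>R X k j)) \<le> \<eta> * osc J (X k)) \<Longrightarrow>
       (\<Sum>k\<le>n. osc J (X k)) \<le> K * osc J (X 0)"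
    using perturbed_contraction[OF J s0 B] by blast
  \<comment> \<open>Serves two purposes: the relative errors of both refinements stay below
    \<open>\<eta>\<close>, and normals of oscillation up to \<open>\<epsilon>\<close> meet the
    smallness condition of the one-step estimates.\<close>
  define \<epsilon> where "\<epsilon> = \<eta> / (4 * B\<^sup>2)"
  have B2: "1 \<le> B\<^sup>2" using B by simp
  have \<epsilon>: "0 < \<epsilon>" "\<epsilon> \<le> 1 / (4 * B\<^sup>2)" "4 * B\<^sup>2 * \<epsilon> = \<eta>"
    using \<eta> B2 B by (auto simp: \<epsilon>_def divide_right_mono)
  show ?thesis
  proof (rule that)
    \<comment> \<open>The first value leaves room for growth of the normals by the factor
      \<open>K\<close>; the second covers both the sum and the displacement, as each step moves a
      point by at most \<open>B + 1\<close> times the current oscillation.\<close>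
    show "0 < \<epsilon> / (K + 1)" "0 < (B + 1) * (K + 1)" using \<epsilon> K B by auto
    fix w :: "nat \<Rightarrow> 'i \<Rightarrow> 'i \<Rightarrow> real" and N P :: "'i \<Rightarrow> real ^ 3" and n
    assume w: "\<And>k. unit_weights (w k) J B"
      and con: "\<And>k. \<exists>s. 1 \<le> s \<and> s \<le> s0 \<and> contracting (\<lambda>t. w (k + t)) J s"
      and N: "\<And>j. j \<in> J \<Longrightarrow> norm (N j) = 1" and small: "osc J N \<le> \<epsilon> / (K + 1)"
    let ?N = "normals w J N" and ?P = "pn_points w J N P"
    \<comment> \<open>The summed estimate up to \<open>k\<close> uses the error bound only at levels
      below \<open>k\<close>, where the induction hypothesis supplies it.\<close>
    have normals: "(\<forall>j\<in>J. norm (?N k j) = 1) \<and> osc J (?N k) \<le> \<epsilon>" for k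
    proof (induction k rule: less_induct)
      case (less k)
      have unit: "norm (?N l j) = 1" and osc: "osc J (?N l) \<le> \<epsilon>" if "l < k" "j \<in> J" for l j
        using less[OF that(1)] that(2) by auto
      have "(\<Sum>l\<le>k. osc J (?N l)) \<le> K * osc J (?N 0)"
      proof (rule sum_osc[OF w con])
        fix l i assume l: "l < k" and i: "i \<in> J"
        have "norm (?N (Suc l) i - (\<Sum>j\<in>J. w l i j *\<^sub>R ?N l j)) \<le> 2 * B\<^sup>2 * (osc J (?N l))\<^sup>2"
          using refined_normal_perturbation(2)[where b = "w l" and N = "?N l", OF J(1) w B unit[OF l] _ i]
            osc[OF l i] \<epsilon>(2) by simp
        also have "\<dots> = (2 * B\<^sup>2 * osc J (?N l)) * osc J (?N l)" by (simp add: power2_eq_square)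
        also have "\<dots> \<le> (4 * B\<^sup>2 * \<epsilon>) * osc J (?N l)"
          using osc[OF l i] osc_nonneg[of J "?N l"] by (intro mult_mono mult_right_mono) auto
        finally show "norm (?N (Suc l) i - (\<Sum>j\<in>J. w l i j *\<^sub>R ?N l j)) \<le> \<eta> * osc J (?N l)"
          by (simp only: \<epsilon>(3))
      qed
      also have "\<dots> \<le> (K + 1) * osc J N"
        using osc_nonneg[of J N] by (simp add: mult_right_mono)
      also have "\<dots> \<le> \<epsilon>" using small K by (simp add: pos_le_divide_eq mult.commute)
      finally have "osc J (?N k) \<le> \<epsilon>"
        using member_le_sum[of k "{..k}" "\<lambda>l. osc J (?N l)"] osc_nonneg by force
      moreover have "norm (?N k j) = 1" if j: "j \<in> J" for j
      proof (cases k)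
        case (Suc l)
        then show ?thesis
          using refined_normal_perturbation(1)[where b = "w l" and N = "?N l", OF J(1) w B unit _ j]
            osc[of l j] j \<epsilon>(2) by simp
      qed (simp add: N j)
      ultimately show ?case by blast
    qed
    have err: "norm (?P (Suc k) i - (\<Sum>j\<in>J. w k i j *\<^sub>R ?P k j)) \<le> \<eta> * osc J (?P k)"
      if i: "i \<in> J" for k i
    proof -
      have "norm (?P (Suc k) i - (\<Sum>j\<in>J. w k i j *\<^sub>R ?P k j)) \<le> 4 * B\<^sup>2 * osc J (?N k) * osc J (?P k)"
        using pn_step_perturbation[where b = "w k" and N = "?N k" and P = "?P k", OF J(1) w B _ _ i]
          normals[of k] \<epsilon>(2) by simp
      also have "\<dots> \<le> 4 * B\<^sup>2 * \<epsilon> * osc J (?P k)"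
        using normals[of k] osc_nonneg[of J "?P k"] by (intro mult_right_mono mult_left_mono) auto
      finally show ?thesis by (simp only: \<epsilon>(3))
    qed
    have total: "(\<Sum>k\<le>n. osc J (?P k)) \<le> K * osc J P" for n
      using sum_osc[of w n ?P, OF w con err] by simp
    have "norm (?P n i - P i) \<le> (B + 1) * (\<Sum>k<n. osc J (?P k))" if i: "i \<in> J" for n i
    proof (induction n)
      case (Suc n)
      have "norm (?P (Suc n) i - ?P n i) \<le> (B + 1) * osc J (?P n)"
        using perturbed_step_bounds(1)[OF J(1) w \<eta>(2) err i i] by blast
      then show ?case
        using Suc norm_triangle_ineq[of "?P (Suc n) i - ?P n i" "?P n i - P i"]
        by (simp add: distrib_left del: pn_points.simps)
    qed simp
    moreover have "(\<Sum>k<n. osc J (?P k)) \<le> K * osc J P"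
      using total[of n] osc_nonneg[of J "?P n"] by (simp flip: lessThan_Suc_atMost del: pn_points.simps)
    moreover have "K * osc J P \<le> (K + 1) * osc J P"
      using osc_nonneg[of J P] by (simp add: mult_right_mono)
    ultimately have move: "norm (?P n i - P i) \<le> (B + 1) * ((K + 1) * osc J P)" if "i \<in> J" for i
      using that B by (meson add_nonneg_nonneg mult_left_mono order_trans zero_le_one)
    have "1 * ((K + 1) * osc J P) \<le> (B + 1) * ((K + 1) * osc J P)"
      using K B osc_nonneg[of J P] by (intro mult_right_mono) auto
    then show "(\<Sum>k\<le>n. osc J (?P k)) \<le> (B + 1) * (K + 1) * osc J P \<and>
        (\<forall>i\<in>J. norm (?P n i - P i) \<le> (B + 1) * (K + 1) * osc J P)"
      using total[of n] \<open>K * osc J P \<le> (K + 1) * osc J P\<close> move by (auto simp: mult.assoc)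
  qed
qed

section \<open>Control points around the extraordinary vertex\<close>

lemma normals_shift: "normals w J N (m + k) = normals (\<lambda>j. w (m + j)) J (normals w J N m) k"
  by (induction k) auto

lemma pn_points_shift:
  "pn_points w J N P (m + k) = pn_points (\<lambda>j. w (m + j)) J (normals w J N m) (pn_points w J N P m) k"
  by (induction k) (auto simp: normals_shift)

lemma unit_weights_uniform:
  assumes "finite F" "finite J" "\<And>e i. e \<in> F \<Longrightarrow> i \<in> J \<Longrightarrow> (\<Sum>j\<in>J. wt e i j) = 1"
  obtains B :: real where "1 \<le> B" "\<And>e. e \<in> F \<Longrightarrow> unit_weights (wt e) J B"
proof
  let ?B = "1 + (\<Sum>e\<in>F. \<Sum>i\<in>J. \<Sum>j\<in>J. \<bar>wt e i j\<bar>)"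
  show "1 \<le> ?B" by (simp add: sum_nonneg)
  fix e assume e: "e \<in> F"
  have "(\<Sum>j\<in>J. \<bar>wt e i j\<bar>) \<le> ?B" if i: "i \<in> J" for i
  proof -
    have "(\<Sum>j\<in>J. \<bar>wt e i j\<bar>) \<le> (\<Sum>i\<in>J. \<Sum>j\<in>J. \<bar>wt e i j\<bar>)"
      using i assms(2) by (intro member_le_sum) (auto intro: sum_nonneg)
    also have "\<dots> \<le> (\<Sum>e\<in>F. \<Sum>i\<in>J. \<Sum>j\<in>J. \<bar>wt e i j\<bar>)"
      using e assms(1) by (intro member_le_sum[of e F "\<lambda>e. \<Sum>i\<in>J. \<Sum>j\<in>J. \<bar>wt e i j\<bar>"])
        (auto intro!: sum_nonneg)
    finally show ?thesis by simp
  qed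
  then show "unit_weights (wt e) J ?B" using assms(3)[OF e] by (auto simp: unit_weights_def)
qed

lemma osc_tendsto_zero:
  assumes "finite J" "\<And>i. i \<in> J \<Longrightarrow> (\<lambda>k. X k i - Y k) \<longlonglongrightarrow> 0"
  shows "(\<lambda>k. osc J (X k)) \<longlonglongrightarrow> 0"
proof -
  have "(\<lambda>k. norm (X k i - X k j)) \<longlonglongrightarrow> 0" if "i \<in> J" "j \<in> J" for i j
    using tendsto_diff[OF assms(2)[OF that(1)] assms(2)[OF that(2)]] by (intro tendsto_norm_zero) simp
  then show ?thesis unfolding osc_def by (intro tendsto_null_sum)
qed

text \<open>The differences to point 0 evolve by the deflated matrix and decay geometrically in each
  coordinate, so the oscillation tends to zero for every start.\<close>

lemma vertex_contracting:
  assumes S: "S \<in> carrier_mat (L + 1) (L + 1)" and rs: "unit_row_sums S" and std: "standard_matrix S"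
    and w: "\<And>k. unit_weights (vertex_weights S k) {..L} B"
  shows "\<exists>s\<ge>1. contracting (vertex_weights S) {..L} s"
proof (rule eventually_contracting[OF finite_atMost w])
  fix P :: "nat \<Rightarrow> real ^ 3"
  let ?X = "linear_points (vertex_weights S) {..L} P"
  have S': "S \<in> carrier_mat (Suc L) (Suc L)" using S by simp
  obtain \<rho> :: real where \<rho>: "0 < \<rho>" "\<rho> < 1"
    and geo: "\<And>d :: nat \<Rightarrow> nat \<Rightarrow> real.
      (\<And>k i. i < L \<Longrightarrow> d (Suc k) i = (\<Sum>j<L. deflated_matrix L S $$ (i, j) * d k j))
      \<Longrightarrow> \<exists>c. \<forall>k. \<forall>i<L. \<bar>d k i\<bar> \<le> c * \<rho> ^ k"
    using standard_deflated_geometric[OF S' rs std] by blast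
  have row: "(\<Sum>j\<le>L. S $$ (i, j)) = 1" if "i \<le> L" for i
    using rs S that by (auto simp: unit_row_sums_def lessThan_Suc_atMost)
  \<comment> \<open>Equal row sums cancel the multiple of \<open>?X k 0\<close>, and the summand
    with \<open>j = 0\<close> vanishes, which leaves an \<open>L\<close> by \<open>L\<close>
    system.\<close>
  have diff: "?X (Suc k) (Suc i) - ?X (Suc k) 0
      = (\<Sum>j<L. deflated_matrix L S $$ (i, j) *\<^sub>R (?X k (Suc j) - ?X k 0))" if i: "i < L" for i k
  proof -
    have "?X (Suc k) (Suc i) - ?X (Suc k) 0 = (\<Sum>j\<le>L. (S $$ (Suc i, j) - S $$ (0, j)) *\<^sub>R ?X k j)"
      by (simp add: vertex_weights_def scaleR_left_diff_distrib sum_subtractf)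
    also have "\<dots> = (\<Sum>j\<le>L. (S $$ (Suc i, j) - S $$ (0, j)) *\<^sub>R (?X k j - ?X k 0))
        + ((\<Sum>j\<le>L. S $$ (Suc i, j)) - (\<Sum>j\<le>L. S $$ (0, j))) *\<^sub>R ?X k 0"
      unfolding sum_subtractf[symmetric] scaleR_sum_left by (simp add: scaleR_diff_right flip: sum.distrib)
    also have "(\<Sum>j\<le>L. S $$ (Suc i, j)) - (\<Sum>j\<le>L. S $$ (0, j)) = 0"
      using i row[of "Suc i"] row[of 0] by simp
    also have "(\<Sum>j\<le>L. (S $$ (Suc i, j) - S $$ (0, j)) *\<^sub>R (?X k j - ?X k 0))
        = (\<Sum>j<L. deflated_matrix L S $$ (i, j) *\<^sub>R (?X k (Suc j) - ?X k 0))"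
      using i unfolding lessThan_Suc_atMost[symmetric]
      by (subst sum.lessThan_Suc_shift) (simp add: deflated_matrix_def)
    finally show ?thesis by simp
  qed
  have lim: "(\<lambda>k. ?X k (Suc i) - ?X k 0) \<longlonglongrightarrow> 0" if i: "i < L" for i
  proof (rule vec_tendstoI)
    fix x
    let ?d = "\<lambda>k i. vec_nth (?X k (Suc i) - ?X k 0) x"
    have "?d (Suc k) i = (\<Sum>j<L. deflated_matrix L S $$ (i, j) * ?d k j)" if "i < L" for k i
      unfolding diff[OF that] by simp
    from geo[of ?d, OF this] obtain c where "\<And>k i. i < L \<Longrightarrow> \<bar>?d k i\<bar> \<le> c * \<rho> ^ k" by blast
    then have "\<forall>\<^sub>F k in sequentially. norm (?d k i) \<le> c * \<rho> ^ k" using i by simp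
    moreover have "(\<lambda>k. c * \<rho> ^ k) \<longlonglongrightarrow> 0"
      using \<rho> by (intro tendsto_mult_right_zero LIMSEQ_realpow_zero) auto
    ultimately have "(\<lambda>k. ?d k i) \<longlonglongrightarrow> 0" by (rule Lim_null_comparison)
    then show "(\<lambda>k. ?d k i) \<longlonglongrightarrow> vec_nth 0 x" by simp
  qed
  show "(\<lambda>k. osc {..L} (?X k)) \<longlonglongrightarrow> 0"
  proof (rule osc_tendsto_zero[OF finite_atMost])
    fix i assume "i \<in> {..L}"
    then show "(\<lambda>k. ?X k i - ?X k 0) \<longlonglongrightarrow> 0" using lim by (cases i) auto
  qed
qed

lemma unit_vertex_normals:
  assumes "\<forall>l\<le>L. norm (N0 l) = 1" "nonvanishing_denominators (vertex_weights S) {..L} N0" "l \<le> L"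
  shows "norm (vertex_normals L S N0 m l) = 1"
proof (cases m)
  case (Suc k)
  then show ?thesis
    using assms by (simp add: vertex_normals_def refined_normal_def nonvanishing_denominators_def)
qed (use assms in \<open>simp add: vertex_normals_def\<close>)

text \<open>Stability asks for small normals, so it is applied to the iteration restarted at a late
  level. Summable oscillations tend to zero, and later points stay within a multiple of the
  oscillation of level \<open>m\<close>, which gives the Cauchy property.\<close>

lemma vertex_points_converge:
  assumes S: "S \<in> carrier_mat (L + 1) (L + 1)" and rs: "unit_row_sums S" and std: "standard_matrix S"
    and unit: "\<forall>l\<le>L. norm (N0 l) = 1"
    and nonv: "nonvanishing_denominators (vertex_weights S) {..L} N0"
    and normals: "(\<lambda>m. osc {..L} (vertex_normals L S N0 m)) \<longlonglongrightarrow> 0"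
  obtains p where "(\<lambda>m. osc {..L} (vertex_points L S N0 Q m)) \<longlonglongrightarrow> 0"
    "(\<lambda>m. vertex_points L S N0 Q m 0) \<longlonglongrightarrow> p"
proof -
  let ?V = "{..L}" and ?Q = "vertex_points L S N0 Q"
  have "(\<Sum>j\<in>?V. S $$ (i, j)) = 1" if "i \<in> ?V" for i
    using rs S that by (auto simp: unit_row_sums_def lessThan_Suc_atMost)
  \<comment> \<open>A one-letter alphabet, as the same matrix acts at every level.\<close>
  then obtain B :: real where B: "1 \<le> B" "\<And>k. unit_weights (vertex_weights S k) ?V B"
    using unit_weights_uniform[of "{()}" ?V "\<lambda>_ i j. S $$ (i, j)"]
    by (auto simp: vertex_weights_def[abs_def])
  obtain s where s: "1 \<le> s" "contracting (vertex_weights S) ?V s"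
    using vertex_contracting[OF S rs std B(2)] by blast
  have ex: "\<exists>t. 1 \<le> t \<and> t \<le> s \<and> contracting (\<lambda>t. vertex_weights S (k + t)) ?V t" for k
    using s by (intro exI[of _ s]) (simp add: vertex_weights_def[abs_def])
  obtain \<delta> K :: real where \<delta>: "0 < \<delta>" and K: "0 < K"
    and stable: "\<And>w N P n. (\<And>k. unit_weights (w k) ?V B) \<Longrightarrow>
       (\<And>k. \<exists>t. 1 \<le> t \<and> t \<le> s \<and> contracting (\<lambda>t. w (k + t)) ?V t) \<Longrightarrow>
       (\<And>j. j \<in> ?V \<Longrightarrow> norm (N j) = 1) \<Longrightarrow> osc ?V N \<le> \<delta> \<Longrightarrow>
       (\<Sum>k\<le>n. osc ?V (pn_points w ?V N P k)) \<le> K * osc ?V P \<and>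
       (\<forall>i\<in>?V. norm (pn_points w ?V N P n i - P i) \<le> K * osc ?V P)"
    using pn_points_stable[OF finite_atMost _ s(1) B(1), of L] by (metis atMost_iff empty_iff le0)
  obtain m0 where m0: "\<And>m. m \<ge> m0 \<Longrightarrow> osc ?V (vertex_normals L S N0 m) \<le> \<delta>"
    using order_tendstoD(2)[OF normals \<delta>] unfolding eventually_sequentially by (meson less_imp_le)
  have shift: "?Q (m + k) = pn_points (vertex_weights S) ?V (vertex_normals L S N0 m) (?Q m) k" for m k
    unfolding vertex_points_def vertex_normals_def
    using pn_points_shift[of "vertex_weights S" ?V N0 Q m k] by (simp add: vertex_weights_def[abs_def])
  have stab: "(\<Sum>k\<le>n. osc ?V (?Q (m + k))) \<le> K * osc ?V (?Q m)"
      "norm (?Q (m + n) 0 - ?Q m 0) \<le> K * osc ?V (?Q m)" if "m \<ge> m0" for m n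
    unfolding shift
    using stable[where w = "vertex_weights S" and N = "vertex_normals L S N0 m" and P = "?Q m" and n = n,
        OF B(2) ex unit_vertex_normals[OF unit nonv] m0[OF that]] by auto
  have "summable (\<lambda>k. osc ?V (?Q (m0 + k)))"
    by (rule bounded_imp_summable[OF osc_nonneg stab(1)]) simp
  then have "(\<lambda>k. osc ?V (?Q (k + m0))) \<longlonglongrightarrow> 0"
    using summable_LIMSEQ_zero by (simp add: add.commute)
  then have lim: "(\<lambda>m. osc ?V (?Q m)) \<longlonglongrightarrow> 0" by (rule LIMSEQ_offset)
  have "Cauchy (\<lambda>m. ?Q m 0)"
  proof (rule metric_CauchyI)
    fix e :: real assume "0 < e"
    then have "0 < e / (2 * K)" using K by simp
    from order_tendstoD(2)[OF lim this] obtain m1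
      where m1: "\<And>m. m \<ge> m1 \<Longrightarrow> osc ?V (?Q m) < e / (2 * K)"
      unfolding eventually_sequentially by blast
    define M where "M = max m0 m1"
    have "K * osc ?V (?Q M) < e / 2" using m1[of M] K by (simp add: M_def field_simps)
    then have "dist (?Q m 0) (?Q M 0) < e / 2" if "m \<ge> M" for m
      using stab(2)[of M "m - M"] that by (simp add: M_def dist_norm)
    then show "\<exists>M. \<forall>m\<ge>M. \<forall>n\<ge>M. dist (?Q m 0) (?Q n 0) < e"
      by (meson dist_triangle_half_l dist_commute_lessI)
  qed
  then obtain p where "(\<lambda>m. ?Q m 0) \<longlonglongrightarrow> p"
    using Cauchy_convergent by (auto simp: convergent_def)
  with lim show ?thesis by (rule that)
qed


subsection \<open>Rings on the regular mesh\<close>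

text \<open>Binary expansion: the half containing the point is kept at each level, the left one on a
  tie.\<close>

lemma nested_interval_exists:
  fixes x :: real and c :: int
  assumes "x \<in> {real_of_int c .. real_of_int c + 1}"
  shows "\<exists>f. f 0 = c \<and> (\<forall>j. f (Suc j) - 2 * f j \<in> {0, 1}) \<and>
    (\<forall>j. 2 ^ j * x \<in> {real_of_int (f j) .. real_of_int (f j) + 1})"
proof -
  define f where "f = rec_nat c (\<lambda>j y. if 2 ^ Suc j * x \<le> 2 * real_of_int y + 1 then 2 * y else 2 * y + 1)"
  have f_Suc: "f (Suc j) = (if 2 ^ Suc j * x \<le> 2 * real_of_int (f j) + 1 then 2 * f j else 2 * f j + 1)" for j
    by (simp add: f_def)
  have "2 ^ j * x \<in> {real_of_int (f j) .. real_of_int (f j) + 1}" for j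
  proof (induction j)
    case 0
    then show ?case using assms by (simp add: f_def)
  next
    case (Suc j)
    have "2 ^ Suc j * x = 2 * (2 ^ j * x)" by simp
    with Suc.IH show ?case unfolding f_Suc by (auto simp del: power_Suc)
  qed
  moreover have "f 0 = c" by (simp add: f_def)
  moreover have "f (Suc j) - 2 * f j \<in> {0, 1}" for j by (simp add: f_Suc)
  ultimately show ?thesis by blast
qed

lemma subpatch_chain_exists:
  assumes "\<sigma> \<in> Sig m"
  shows "\<exists>k. subpatch_chain m \<sigma> k"
proof -
  obtain \<tau> where \<tau>: "\<sigma> = (1 / 2 ^ m) *\<^sub>R \<tau>" "\<tau> \<in> {0..1} \<times> {0..1} - {0..<1/2} \<times> {0..<1/2}"
    using assms by (auto simp: Sig_def)
  define x y where "x = 2 * fst \<tau>" and "y = 2 * snd \<tau>"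
  have xy: "0 \<le> x" "x \<le> 2" "0 \<le> y" "y \<le> 2" "1 \<le> x \<or> 1 \<le> y"
    using \<tau>(2) by (cases \<tau>; auto simp: x_def y_def)+
  \<comment> \<open>The boundary value 2 goes to cell 1. The cell \<open>(0, 0)\<close> does not
    occur because one coordinate is at least 1.\<close>
  define c d :: int where "c = (if 1 \<le> x then 1 else 0)" and "d = (if 1 \<le> y then 1 else 0)"
  have cd: "x \<in> {real_of_int c .. real_of_int c + 1}" "y \<in> {real_of_int d .. real_of_int d + 1}"
      "(c, d) \<in> ring_cells"
    using xy by (auto simp: c_def d_def ring_cells_def)
  obtain f where f: "f 0 = c" "\<And>j. f (Suc j) - 2 * f j \<in> {0, 1}"
      "\<And>j. 2 ^ j * x \<in> {real_of_int (f j) .. real_of_int (f j) + 1}"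
    using nested_interval_exists[OF cd(1)] by blast
  obtain g where g: "g 0 = d" "\<And>j. g (Suc j) - 2 * g j \<in> {0, 1}"
      "\<And>j. 2 ^ j * y \<in> {real_of_int (g j) .. real_of_int (g j) + 1}"
    using nested_interval_exists[OF cd(2)] by blast
  have scale: "2 ^ (m + 1 + j) * fst \<sigma> = 2 ^ j * x" "2 ^ (m + 1 + j) * snd \<sigma> = 2 ^ j * y" for j
    by (simp_all add: \<tau>(1) x_def y_def power_add)
  have "subpatch_chain m \<sigma> (\<lambda>j. (f j, g j))"
    unfolding subpatch_chain_def nested_cells_def fst_conv snd_conv scale
    using cd(3) f g by (simp only: simp_thms)
  then show ?thesis by blast
qed

definition cell_weights :: "(int \<times> int \<Rightarrow> real) \<Rightarrow> int \<times> int \<Rightarrow> int \<times> int \<Rightarrow> int \<times> int \<Rightarrow> real" where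
  "cell_weights a e \<alpha> \<beta> = mask_weight a (e + \<alpha>) \<beta>"

text \<open>The subpatch matrices depend only on the position of a cell in its parent, so all chains are
  infinite words over an alphabet of four letters.\<close>

lemma subpatch_matrix_eq_cell_weights:
  "subpatch_matrix a k j = cell_weights a (fst (k (Suc j)) - 2 * fst (k j), snd (k (Suc j)) - 2 * snd (k j))"
  by (intro ext) (simp add: subpatch_matrix_def cell_weights_def mask_weight_def algebra_simps)

text \<open>Tails of chains are again words over the four letters, hence one \<open>s0\<close> and
  one \<open>B\<close> serve all chains and all starting levels.\<close>

lemma regular_uniformly_contracting:
  assumes reg: "regular_scheme a J" and conv: "regular_convergent a J"
  obtains s0 B where "1 \<le> s0" "1 \<le> B"
    "\<And>k j. nested_cells k \<Longrightarrow> unit_weights (subpatch_matrix a k j) J B"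
    "\<And>k j. nested_cells k \<Longrightarrow>
      \<exists>s. 1 \<le> s \<and> s \<le> s0 \<and> contracting (\<lambda>t. subpatch_matrix a k (j + t)) J s"
proof -
  let ?F = "{0, 1} \<times> {0, 1} :: (int \<times> int) set"
  have J: "finite J" and supp: "\<And>e \<alpha> \<beta>. e \<in> ?F \<Longrightarrow> \<alpha> \<in> J \<Longrightarrow> mask_weight a (e + \<alpha>) \<beta> \<noteq> 0 \<Longrightarrow> \<beta> \<in> J"
    and rs: "\<And>\<alpha>. (\<Sum>\<beta> | mask_weight a \<alpha> \<beta> \<noteq> 0. mask_weight a \<alpha> \<beta>) = 1"
    using reg unfolding regular_scheme_def by blast+
  have "(\<Sum>\<beta>\<in>J. cell_weights a e \<alpha> \<beta>) = 1" if "e \<in> ?F" "\<alpha> \<in> J" for e \<alpha>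
  proof -
    \<comment> \<open>Every index with nonzero weight lies in \<open>J\<close>, so the row sum over
      \<open>J\<close> is that of the whole mask.\<close>
    have "(\<Sum>\<beta>\<in>J. mask_weight a (e + \<alpha>) \<beta>)
        = (\<Sum>\<beta> | mask_weight a (e + \<alpha>) \<beta> \<noteq> 0. mask_weight a (e + \<alpha>) \<beta>)"
      using supp[OF that] J by (intro sum.mono_neutral_right) auto
    then show ?thesis by (simp add: cell_weights_def rs)
  qed
  then obtain B :: real where B: "1 \<le> B" "\<And>e. e \<in> ?F \<Longrightarrow> unit_weights (cell_weights a e) J B"
    using unit_weights_uniform[of ?F J "cell_weights a"] J by (metis finite.emptyI finite.insertI finite_cartesian_product)
  have "(\<lambda>k. osc J (linear_points (\<lambda>j. cell_weights a (e j)) J P k)) \<longlonglongrightarrow> 0"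
    if e: "range e \<subseteq> ?F" for e P
  proof -
    \<comment> \<open>Every word arises as the relative positions in a chain of cells starting at
      the origin, so the assumed convergence applies to all words.\<close>
    define k where "k = rec_nat (0, 0) (\<lambda>j y. (2 * fst y + fst (e j), 2 * snd y + snd (e j)))"
    have k_Suc: "k (Suc j) = (2 * fst (k j) + fst (e j), 2 * snd (k j) + snd (e j))" for j
      by (simp add: k_def)
    have "e j \<in> ?F" for j using e by blast
    then have "nested_cells k"
      by (simp only: nested_cells_def k_Suc mem_Times_iff fst_conv snd_conv add_diff_cancel_left' simp_thms)
    moreover have "(\<lambda>j. cell_weights a (e j)) = subpatch_matrix a k"
      by (rule ext) (simp add: subpatch_matrix_eq_cell_weights k_Suc)
    ultimately obtain p where
      "\<forall>\<alpha>\<in>J. (\<lambda>j. linear_points (\<lambda>j. cell_weights a (e j)) J P j \<alpha>) \<longlonglongrightarrow> p"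
      using conv unfolding regular_convergent_def by metis
    then show ?thesis by (intro osc_tendsto_zero[OF J, where Y = "\<lambda>_. p"]) (simp add: LIM_zero)
  qed
  note lim = this
  have "finite ?F" by simp
  from uniformly_contracting[where wt = "cell_weights a", OF J this B(2) lim]
  obtain s0 where s0: "1 \<le> s0" "\<And>e. range e \<subseteq> ?F \<Longrightarrow>
      \<exists>s. 1 \<le> s \<and> s \<le> s0 \<and> contracting (\<lambda>j. cell_weights a (e j)) J s"
    by blast
  show ?thesis
  proof (rule that[OF s0(1) B(1)])
    fix k :: "nat \<Rightarrow> int \<times> int" and j
    let ?e = "\<lambda>j. (fst (k (Suc j)) - 2 * fst (k j), snd (k (Suc j)) - 2 * snd (k j))"
    assume "nested_cells k"
    then have e: "?e j \<in> ?F" for j by (simp only: nested_cells_def mem_Times_iff fst_conv snd_conv)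
    show "unit_weights (subpatch_matrix a k j) J B"
      unfolding subpatch_matrix_eq_cell_weights by (rule B(2)[OF e])
    have "range (\<lambda>t. ?e (j + t)) \<subseteq> ?F" using e by blast
    from s0(2)[OF this]
    show "\<exists>s. 1 \<le> s \<and> s \<le> s0 \<and> contracting (\<lambda>t. subpatch_matrix a k (j + t)) J s"
      by (simp only: subpatch_matrix_eq_cell_weights add_Suc_right)
  qed
qed

text \<open>A point of the ring is the limit of the PN iteration along one chain, and stability
  keeps all iterates near the initial control points. The constants come from the mask and
  \<open>J\<close> alone, so they are uniform in level, sector and parameter.\<close>

lemma pn_ring_near_control_point:
  fixes a :: "int \<times> int \<Rightarrow> real" and J :: "(int \<times> int) set"
  assumes reg: "regular_scheme a J" and conv: "regular_convergent a J"
  obtains \<delta> K :: real where "0 < \<delta>" "0 < K"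
    "\<And>n L sel Ns Qs x m s. pn_rings n a J sel Ns Qs x \<Longrightarrow>
      (\<forall>c\<in>ring_cells. \<forall>i<n. \<forall>\<alpha>\<in>J. sel c i \<alpha> \<le> (L :: nat)) \<Longrightarrow>
      (\<forall>l\<le>L. norm (Ns m l) = 1) \<Longrightarrow> osc {..L} (Ns m) \<le> \<delta> \<Longrightarrow> s \<in> ring_domain n m \<Longrightarrow>
      norm (x m s - Qs m 0) \<le> K * osc {..L} (Qs m)"
proof -
  have J: "finite J" "J \<noteq> {}" using reg by (auto simp: regular_scheme_def)
  obtain s0 B where s0: "1 \<le> s0" and B: "1 \<le> B"
    and w: "\<And>k j. nested_cells k \<Longrightarrow> unit_weights (subpatch_matrix a k j) J B"
    and con: "\<And>k j. nested_cells k \<Longrightarrow>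
      \<exists>s. 1 \<le> s \<and> s \<le> s0 \<and> contracting (\<lambda>t. subpatch_matrix a k (j + t)) J s"
    using regular_uniformly_contracting[OF reg conv] by metis
  obtain \<delta> K :: real where \<delta>: "0 < \<delta>" and K: "0 < K"
    and stable: "\<And>w N P n. (\<And>k. unit_weights (w k) J B) \<Longrightarrow>
       (\<And>k. \<exists>t. 1 \<le> t \<and> t \<le> s0 \<and> contracting (\<lambda>t. w (k + t)) J t) \<Longrightarrow>
       (\<And>j. j \<in> J \<Longrightarrow> norm (N j) = 1) \<Longrightarrow> osc J N \<le> \<delta> \<Longrightarrow>
       (\<Sum>k\<le>n. osc J (pn_points w J N P k)) \<le> K * osc J P \<and>
       (\<forall>i\<in>J. norm (pn_points w J N P n i - P i) \<le> K * osc J P)"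
    using pn_points_stable[OF J s0 B] by metis
  define c where "c = real (card J) ^ 2"
  have "0 < card J" using J by (simp add: card_gt_0_iff)
  then have c: "0 < c" by (simp add: c_def)
  show ?thesis
  proof (rule that)
    \<comment> \<open>Passing from all control points to the selected ones costs a factor
      \<open>c\<close>; the summand 1 accounts for the distance from a selected point to point
      0.\<close>
    show "0 < \<delta> / c" "0 < K * c + 1" using \<delta> K c by (auto simp: add_pos_pos)
    fix n L :: nat and sel Ns Qs and x :: "nat \<Rightarrow> (real \<times> real) \<times> nat \<Rightarrow> real ^ 3"
      and m and s :: "(real \<times> real) \<times> nat"
    assume ring: "pn_rings n a J sel Ns Qs x"
      and sel: "\<forall>c\<in>ring_cells. \<forall>i<n. \<forall>\<alpha>\<in>J. sel c i \<alpha> \<le> L"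
      and unit: "\<forall>l\<le>L. norm (Ns m l) = 1" and small: "osc {..L} (Ns m) \<le> \<delta> / c"
      and s: "s \<in> ring_domain n m"
    obtain \<sigma> i where si: "s = (\<sigma>, i)" "\<sigma> \<in> Sig m" "i < n"
      using s by (auto simp: ring_domain_def)
    obtain k where k: "subpatch_chain m \<sigma> k" using subpatch_chain_exists[OF si(2)] by blast
    then have cell: "k 0 \<in> ring_cells" and nest: "nested_cells k" by (auto simp: subpatch_chain_def)
    let ?sel = "sel (k 0) i"
    let ?P = "pn_points (subpatch_matrix a k) J (\<lambda>\<beta>. Ns m (?sel \<beta>)) (\<lambda>\<beta>. Qs m (?sel \<beta>))"
    have le: "?sel \<alpha> \<in> {..L}" if "\<alpha> \<in> J" for \<alpha> using sel cell si(3) that by auto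
    have osc_sel: "osc J (\<lambda>\<beta>. X (?sel \<beta>)) \<le> c * osc {..L} X" for X :: "nat \<Rightarrow> real ^ 3"
      unfolding c_def using le by (intro osc_le norm_diff_le_osc) auto
    have "osc J (\<lambda>\<beta>. Ns m (?sel \<beta>)) \<le> c * osc {..L} (Ns m)" by (rule osc_sel)
    also have "\<dots> \<le> \<delta>" using small c by (simp add: pos_le_divide_eq mult.commute)
    finally have small': "osc J (\<lambda>\<beta>. Ns m (?sel \<beta>)) \<le> \<delta>" .
    obtain \<alpha> where \<alpha>: "\<alpha> \<in> J" using J by blast
    have "norm (?P j \<alpha> - Qs m (?sel \<alpha>)) \<le> K * (c * osc {..L} (Qs m))" for j
    proof -
      have "norm (?P j \<alpha> - Qs m (?sel \<alpha>)) \<le> K * osc J (\<lambda>\<beta>. Qs m (?sel \<beta>))"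
        using stable[where w = "subpatch_matrix a k" and N = "\<lambda>\<beta>. Ns m (?sel \<beta>)"
            and P = "\<lambda>\<beta>. Qs m (?sel \<beta>)" and n = j, OF w[OF nest] con[OF nest] _ small']
          unit le \<alpha> by auto
      also have "\<dots> \<le> K * (c * osc {..L} (Qs m))"
        using osc_sel K by (intro mult_left_mono) auto
      finally show ?thesis .
    qed
    moreover have "(\<lambda>j. ?P j \<alpha>) \<longlonglongrightarrow> x m s"
      using ring s k \<alpha> unfolding pn_rings_def si(1) by blast
    then have "(\<lambda>j. norm (?P j \<alpha> - Qs m (?sel \<alpha>))) \<longlonglongrightarrow> norm (x m s - Qs m (?sel \<alpha>))"
      by (intro tendsto_intros)
    ultimately have "norm (x m s - Qs m (?sel \<alpha>)) \<le> K * (c * osc {..L} (Qs m))"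
      by (intro LIMSEQ_le_const2) auto
    moreover have "norm (Qs m (?sel \<alpha>) - Qs m 0) \<le> osc {..L} (Qs m)"
      using le[OF \<alpha>] by (intro norm_diff_le_osc) auto
    ultimately show "norm (x m s - Qs m 0) \<le> (K * c + 1) * osc {..L} (Qs m)"
      using norm_triangle_ineq[of "x m s - Qs m (?sel \<alpha>)" "Qs m (?sel \<alpha>) - Qs m 0"]
      by (simp add: algebra_simps)
  qed
qed

section \<open>Convergence of the rings\<close>

theorem theorem4p7:
  fixes L n r :: nat
    and S :: "real mat"
    and Q N0 :: "nat \<Rightarrow> real ^ 3"
    and a :: "int \<times> int \<Rightarrow> real"
    and J :: "(int \<times> int) set"
    and sel :: "int \<times> int \<Rightarrow> nat \<Rightarrow> int \<times> int \<Rightarrow> nat"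
    and G :: "nat \<Rightarrow> (real \<times> real) \<times> nat \<Rightarrow> real"
    and xt :: "nat \<Rightarrow> (real \<times> real) \<times> nat \<Rightarrow> real ^ 3"
    and c\<^sub>2 \<gamma> :: real
  assumes "n > 0"
    and "S \<in> carrier_mat (L + 1) (L + 1)"
    and "unit_row_sums S"
    and "standard_matrix S"
    and "\<forall>l\<le>L. norm (N0 l) = 1"
    and "nonvanishing_denominators (vertex_weights S) {..L} N0"
    and "c\<^sub>2 > 0" and "0 < \<gamma>" and "\<gamma> < 1"
    and "\<forall>k. \<forall>j\<le>L. \<forall>l\<le>L. norm (vertex_normals L S N0 k j - vertex_normals L S N0 k l) \<le> c\<^sub>2 * \<gamma> ^ k"
    and "regular_scheme a J"
    and "regular_convergent a J"
    and "\<forall>c\<in>ring_cells. \<forall>i<n. \<forall>\<alpha>\<in>J. sel c i \<alpha> \<le> L"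
    and "generating_functions L n a J sel r G"
    and "\<forall>m k. \<forall>i<n. k 0 \<in> ring_cells \<longrightarrow> nested_cells k \<longrightarrow>
           nonvanishing_denominators (subpatch_matrix a k) J (\<lambda>\<beta>. vertex_normals L S N0 m (sel (k 0) i \<beta>))"
    and "pn_rings n a J sel (vertex_normals L S N0) (vertex_points L S N0 Q) xt"
  shows "\<exists>p. rings_converge_to n xt p"
proof -
  let ?N = "vertex_normals L S N0" and ?Q = "vertex_points L S N0 Q"
  have "(\<lambda>m. osc {..L} (?N m)) \<longlonglongrightarrow> 0"
  proof (rule osc_tendsto_zero)
    fix l assume l: "l \<in> {..L}"
    have "(\<lambda>m. c\<^sub>2 * \<gamma> ^ m) \<longlonglongrightarrow> 0"
      using assms(8,9) by (intro tendsto_mult_right_zero LIMSEQ_realpow_zero) auto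
    then show "(\<lambda>m. ?N m l - ?N m 0) \<longlonglongrightarrow> 0"
      by (rule Lim_null_comparison[rotated]) (use assms(10) l in auto)
  qed simp
  note normals = this
  obtain p where osc: "(\<lambda>m. osc {..L} (?Q m)) \<longlonglongrightarrow> 0" and p: "(\<lambda>m. ?Q m 0) \<longlonglongrightarrow> p"
    using vertex_points_converge[OF assms(2-6) normals] by blast
  obtain \<delta> K :: real where \<delta>: "0 < \<delta>" and near: "\<And>m s. osc {..L} (?N m) \<le> \<delta> \<Longrightarrow> s \<in> ring_domain n m \<Longrightarrow>
      norm (xt m s - ?Q m 0) \<le> K * osc {..L} (?Q m)"
    using pn_ring_near_control_point[OF assms(11,12)] assms(13,16) unit_vertex_normals[OF assms(5,6)] by metis
  have "rings_converge_to n xt p"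
    unfolding rings_converge_to_def
  proof (intro allI impI)
    fix s assume s: "\<forall>m. s m \<in> ring_domain n m"
    \<comment> \<open>The ring estimate holds once the normals are close enough together, and
      uniformly in the parameter, so \<open>s m\<close> may vary with \<open>m\<close>.\<close>
    have "\<forall>\<^sub>F m in sequentially. osc {..L} (?N m) < \<delta>" using order_tendstoD(2)[OF normals \<delta>] .
    then have "\<forall>\<^sub>F m in sequentially. norm (xt m (s m) - ?Q m 0) \<le> K * osc {..L} (?Q m)"
      by eventually_elim (use near s in auto)
    then have "(\<lambda>m. xt m (s m) - ?Q m 0) \<longlonglongrightarrow> 0"
      by (rule Lim_null_comparison) (rule tendsto_mult_right_zero[OF osc])
    from tendsto_add[OF this p] show "(\<lambda>m. xt m (s m)) \<longlonglongrightarrow> p" by simp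
  qed
  then show ?thesis by blast
qed

end
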